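(* Let $4\le p\le n-1$, let $\langle R,S,T\rangle$ be a partition of $V$ with $0,n\in T$. The generalized max-cut inequality $$x((S:T))+\sum_{i\in R}x(\delta^+(i))\le \left\lfloor \tfrac{p+|R|}{2}\right\rfloor$$ is valid for $P^p_{0,n}(D)$, and it is facet defining for $P^p_{0,n}(D)$ if and only if $p+|R|$ is odd, $|S|>(p-|R|)/2$, $|T\setminus\{0\}|>(p-|R|)/2$, and either (i) $p=|R|+3$, $|R|\ge 2$ and $|T|=3$, or (ii) $p\ge |R|+5$.
   Context: Let $n$ be a positive integer, $V=\{0,1,\dots,n\}$, and let $D=(V,A)$ be the digraph whose arc set $A$ consists of all ordered pairs $(i,j)$ with $i\neq j$, $i,j\in V$, except that no arc enters node $0$, no arc leaves node $n$, and the arc $(0,n)$ is absent. A $(0,n)$-$p$-path is a simple directed path in $D$ from $0$ to $n$ with exactly $p$ arcs. $P^p_{0,n}(D)\subseteq\mathbb{R}^A$ is the convex hull of the incidence vectors of all $(0,n)$-$p$-paths. For $F\subseteq A$, $x(F)=\sum_{(i,j)\in F}x_{ij}$; $\delta^+(k)$ is the set of arcs of $A$ leaving node $k$. For node sets $S,T$, $(S:T)=\{(i,j)\in A: i\in S, j\in T\}$. Facet defining means valid and defining a face of dimension $\dim P^p_{0,n}(D)-1$. *)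

theory Defs
  imports Complex_Main
begin

type_synonym arc = "nat \<times> nat"
type_synonym vec = "arc \<Rightarrow> real"   (* points of R^A, coordinates outside A are 0 *)

definition Vn :: "nat \<Rightarrow> nat set" where
  "Vn n = {0..n}"

definition arcs :: "nat \<Rightarrow> arc set" where
  "arcs n = {(i,j). i \<in> Vn n \<and> j \<in> Vn n \<and> i \<noteq> j \<and> j \<noteq> 0 \<and> i \<noteq> n \<and> (i,j) \<noteq> (0,n)}"

definition is_pPath :: "nat \<Rightarrow> nat \<Rightarrow> nat list \<Rightarrow> bool" where
  "is_pPath n p vs \<longleftrightarrow> length vs = p + 1 \<and> distinct vs \<and> hd vs = 0 \<and> last vs = n
     \<and> (\<forall>k < p. (vs ! k, vs ! Suc k) \<in> arcs n)"

definition path_arcs :: "nat list \<Rightarrow> arc set" where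
  "path_arcs vs = set (zip vs (tl vs))"

definition incidence :: "nat list \<Rightarrow> vec" where
  "incidence vs = (\<lambda>a. if a \<in> path_arcs vs then 1 else 0)"

definition convhull :: "vec set \<Rightarrow> vec set" where
  "convhull Y = {x. \<exists>F c. finite F \<and> F \<noteq> {} \<and> F \<subseteq> Y \<and> (\<forall>v\<in>F. c v \<ge> 0)
       \<and> (\<Sum>v\<in>F. c v) = 1 \<and> x = (\<lambda>a. \<Sum>v\<in>F. c v * v a)}"

definition pathPolytope :: "nat \<Rightarrow> nat \<Rightarrow> vec set" where
  "pathPolytope n p = convhull (incidence ` {vs. is_pPath n p vs})"

definition aff_independent :: "vec set \<Rightarrow> bool" where
  "aff_independent X \<longleftrightarrow> finite X \<and>
     (\<forall>c. (\<Sum>v\<in>X. c v) = 0 \<and> (\<forall>a. (\<Sum>v\<in>X. c v * v a) = 0) \<longrightarrow> (\<forall>v\<in>X. c v = 0))"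

definition pdim :: "vec set \<Rightarrow> int" where
  "pdim C = (if C = {} then -1
             else Max {int (card X) | X. X \<subseteq> C \<and> aff_independent X} - 1)"

definition xsum :: "vec \<Rightarrow> arc set \<Rightarrow> real" where
  "xsum x F = (\<Sum>a\<in>F. x a)"

definition delta_out :: "nat \<Rightarrow> nat \<Rightarrow> arc set" where
  "delta_out n k = {(i,j) \<in> arcs n. i = k}"

definition cut_arcs :: "nat \<Rightarrow> nat set \<Rightarrow> nat set \<Rightarrow> arc set" where
  "cut_arcs n S T = {(i,j) \<in> arcs n. i \<in> S \<and> j \<in> T}"

definition valid_ineq :: "vec set \<Rightarrow> (vec \<Rightarrow> real) \<Rightarrow> real \<Rightarrow> bool" where
  "valid_ineq P f b \<longleftrightarrow> (\<forall>x\<in>P. f x \<le> b)"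

definition facet_defining :: "vec set \<Rightarrow> (vec \<Rightarrow> real) \<Rightarrow> real \<Rightarrow> bool" where
  "facet_defining P f b \<longleftrightarrow> valid_ineq P f b \<and> pdim {x\<in>P. f x = b} = pdim P - 1"

definition gmc_lhs :: "nat \<Rightarrow> nat set \<Rightarrow> nat set \<Rightarrow> nat set \<Rightarrow> vec \<Rightarrow> real" where
  "gmc_lhs n R S T x = xsum x (cut_arcs n S T) + (\<Sum>i\<in>R. xsum x (delta_out n i))"

end

theory Submission
  imports Defs "HOL-Library.Function_Algebras"
begin

text \<open>
  For a path through the nodes \<open>0 = v\<^sub>0, \<dots>, v\<^sub>p = n\<close>, twice the left-hand side equals \<open>p + |R|\<close> minus
  the number of \<open>R\<close>-nodes off the path, minus the number of its \<open>S\<close>-nodes not followed by a \<open>T\<close>-node,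
  minus the number of its \<open>T\<close>-nodes other than \<open>0\<close> not preceded by an \<open>S\<close>-node. This gives validity;
  for \<open>p + |R|\<close> odd a path is tight iff exactly one such defect occurs.

  If one of the conditions fails, counting nodes shows that (up to two small exceptional cases) two arc
  variables vanish on the face, which therefore has codimension at least two. If all of them hold, let
  a linear functional \<open>c\<close> be constant on tight paths. After subtracting a node potential, exchanges of
  one, two or three nodes between tight paths that share all their other nodes show that \<open>c\<close> depends
  only on the classes \<open>R\<close>, \<open>S\<close>, \<open>T\<close> of the two ends of an arc and lies in a two-parameter family, which
  consists of the multiples of the inequality up to potentials and constants.
\<close>

section \<open>Linear algebra on the space of arc vectors\<close>

text \<open>The dimension of the polytope is never computed; only the codimension of the face is
  needed, and it is handled dually. The face is a facet once some path is not tight and every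
  functional vanishing on all tight paths is a multiple of the slack on all paths; two further
  independent equations on the face refute it. The exchanges need a common remainder of the two
  paths that carries no defect and whose last node can be prescribed away from the exchanged nodes.
  If \<open>p = |R| + 3\<close> this remainder consists of \<open>R\<close>-nodes only, and a second
  \<open>R\<close>-node must exist to end it; if \<open>p \<ge> |R| + 5\<close> it also contains an
  \<open>S\<close>-\<open>T\<close> pair and may end in a \<open>T\<close>-node. This is how the two
  alternatives of the theorem enter the sufficiency argument.\<close>

definition vscale :: "real \<Rightarrow> vec \<Rightarrow> vec" where
  "vscale r x = (\<lambda>a. r * x a)"

interpretation fv: vector_space vscale
  by unfold_locales (auto simp: vscale_def fun_eq_iff algebra_simps)

interpretation fvr: vector_space_pair vscale "(*) :: real \<Rightarrow> real \<Rightarrow> real"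
  by unfold_locales (auto simp: algebra_simps)

lemma sum_vec_apply: "(\<Sum>v\<in>F. f v) a = (\<Sum>v\<in>F. f v (a :: arc) :: real)"
  by (induction F rule: infinite_finite_induct) auto

definition lin :: "nat \<Rightarrow> vec \<Rightarrow> vec \<Rightarrow> real" where
  "lin n c x = (\<Sum>a\<in>arcs n. c a * x a)"

lemma finite_arcs: "finite (arcs n)"
  by (rule finite_subset[of _ "Vn n \<times> Vn n"]) (auto simp: arcs_def Vn_def)

lemma lin_sum: "lin n c (\<lambda>a. \<Sum>v\<in>F. w v * v a) = (\<Sum>v\<in>F. w v * lin n c v)"
proof -
  have "lin n c (\<lambda>a. \<Sum>v\<in>F. w v * v a) = (\<Sum>a\<in>arcs n. \<Sum>v\<in>F. w v * (c a * v a))"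
    by (simp only: lin_def sum_distrib_left mult.left_commute)
  also have "\<dots> = (\<Sum>v\<in>F. w v * lin n c v)"
    by (subst sum.swap) (simp only: lin_def sum_distrib_left)
  finally show ?thesis .
qed

lemma lin_linear: "Vector_Spaces.linear vscale (*) (lin n c)"
proof unfold_locales
  show "lin n c (x + y) = lin n c x + lin n c y" for x y
    by (simp only: lin_def plus_fun_apply distrib_left sum.distrib)
  show "lin n c (vscale r x) = r * lin n c x" for r x
    by (simp only: lin_def vscale_def mult.left_commute sum_distrib_left)
qed

lemma lin_diff_coeffs: "lin n (\<lambda>a. c a - r * h a) x = lin n c x - r * lin n h x"
  by (simp only: lin_def left_diff_distrib sum_subtractf sum_distrib_left mult.assoc)

lemma lin_span_zero:
  assumes "x \<in> fv.span C" "\<And>y. y \<in> C \<Longrightarrow> lin n c y = 0"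
  shows "lin n c x = 0"
  using fvr.linear_eq_0_on_span[OF lin_linear assms(2) assms(1)] .

text \<open>Applied with \<open>h\<close> the indicator of the arcs leaving node \<open>0\<close>: since \<open>x(\<delta>\<^sup>+(0)) = 1\<close> on the
  polytope, dimensions can be computed linearly.\<close>

lemma aff_independent_iff_independent:
  assumes h: "\<And>x. x \<in> X \<Longrightarrow> lin n h x = 1"
  shows "aff_independent X \<longleftrightarrow> finite X \<and> fv.independent X"
proof (cases "finite X")
  case True
  have *: "(\<Sum>v\<in>X. c v) = 0" if "\<And>a. (\<Sum>v\<in>X. c v * v a) = 0" for c
  proof -
    have "0 = lin n h (\<lambda>a. \<Sum>v\<in>X. c v * v a)" 
      by (simp only: lin_def that simp_thms mult_zero_right sum.neutral_const)
    also have "\<dots> = (\<Sum>v\<in>X. c v)" using h by (simp add: lin_sum)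
    finally show ?thesis by simp
  qed
  have eq: "(\<Sum>v\<in>X. vscale (c v) v) = 0 \<longleftrightarrow> (\<forall>a. (\<Sum>v\<in>X. c v * v a) = 0)" for c
    by (simp add: fun_eq_iff sum_vec_apply vscale_def)
  have "fv.independent X \<longleftrightarrow> (\<forall>c. (\<forall>a. (\<Sum>v\<in>X. c v * v a) = 0) \<longrightarrow> (\<forall>v\<in>X. c v = 0))"
    unfolding fv.dependent_finite[OF True] eq by blast
  also have "\<dots> \<longleftrightarrow> (\<forall>c. (\<Sum>v\<in>X. c v) = 0 \<and> (\<forall>a. (\<Sum>v\<in>X. c v * v a) = 0) \<longrightarrow> (\<forall>v\<in>X. c v = 0))"
    using * by (intro iff_allI) auto
  finally show ?thesis using True by (simp only: aff_independent_def simp_thms)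
qed (simp add: aff_independent_def)

text \<open>\<open>vec\<close> is infinite-dimensional; the finite spanning set \<open>G\<close>
  bounds the independent subsets and makes the \<open>Max\<close> in \<open>pdim\<close> range over
  a finite set. The \<open>- 1\<close> arises because \<open>C\<close> lies on a hyperplane that
  misses the origin.\<close>

lemma pdim_eq_dim:
  assumes h: "\<And>x. x \<in> C \<Longrightarrow> lin n h x = 1"
    and fin: "finite G" "C \<subseteq> fv.span G"
  shows "pdim C = int (fv.dim C) - 1"
proof (cases "C = {}")
  case True
  then show ?thesis by (simp add: pdim_def fv.dim_eq_card_independent[OF fv.independent_empty, simplified])
next
  case False
  obtain B where B: "B \<subseteq> C" "fv.independent B" "C \<subseteq> fv.span B" "card B = fv.dim C"
    using fv.basis_exists by blast
  have finB: "finite B"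
    using fv.independent_span_bound[OF fin(1) B(2)] B(1) fin(2) by blast
  define D where "D = {int (card X) | X. X \<subseteq> C \<and> aff_independent X}"
  have aff: "aff_independent X \<longleftrightarrow> finite X \<and> fv.independent X" if "X \<subseteq> C" for X
    using aff_independent_iff_independent[of X n h] h that by blast
  have le: "int (card X) \<le> int (card B)" if "X \<subseteq> C" "aff_independent X" for X
    using fv.independent_span_bound[OF finB] aff[OF that(1)] that B(3) by auto
  have "Max D = int (card B)"
  proof (rule Max_eqI)
    have "D \<subseteq> {0..int (card B)}" using le by (auto simp: D_def)
    then show "finite D" by (rule finite_subset) simp
    show "d \<le> int (card B)" if "d \<in> D" for d using that le by (auto simp: D_def)
    show "int (card B) \<in> D" using B(1,2) finB aff[OF B(1)] by (auto simp: D_def)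
  qed
  then show ?thesis using False B(4) by (simp add: pdim_def D_def)
qed

text \<open>A linear functional obtained by extension from a basis is given by its values at the
  unit vectors of the arcs, because all vectors involved vanish off \<open>arcs n\<close>.\<close>

lemma separating_functional:
  assumes supp: "\<And>x a. x \<in> insert y C \<Longrightarrow> a \<notin> arcs n \<Longrightarrow> x a = 0"
    and y: "y \<notin> fv.span C"
  obtains c where "\<And>x. x \<in> C \<Longrightarrow> lin n c x = 0" "lin n c y = 1"
proof -
  obtain B where B: "B \<subseteq> C" "fv.independent B" "C \<subseteq> fv.span B" "card B = fv.dim C"
    using fv.basis_exists by blast
  have "fv.span B \<subseteq> fv.span C" using B(1) by (rule fv.span_mono)
  then have yB: "y \<notin> fv.span B" using y by blast
  then have ind: "fv.independent (insert y B)" using B(2) fv.independent_insertI by blast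
  obtain g where g: "Vector_Spaces.linear vscale (*) g"
    "\<forall>x\<in>insert y B. g x = (if x = y then 1 else 0 :: real)"
    using fvr.linear_independent_extend[OF ind, of "\<lambda>x. if x = y then 1 else 0"] by blast
  interpret g: Vector_Spaces.linear vscale "(*)" g by (rule g(1))
  define c where "c a = g (\<lambda>a'. if a' = a then 1 else 0)" for a
  have gc: "g x = lin n c x" if "\<And>a. a \<notin> arcs n \<Longrightarrow> x a = 0" for x
  proof -
    have "x = (\<Sum>a\<in>arcs n. vscale (x a) (\<lambda>a'. if a' = a then 1 else 0))"
      using that by (intro ext) (simp only: sum_vec_apply vscale_def, simp add: finite_arcs if_distrib cong: if_cong)
    then have "g x = g (\<Sum>a\<in>arcs n. vscale (x a) (\<lambda>a'. if a' = a then 1 else 0))"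
      by (rule arg_cong)
    also have "\<dots> = (\<Sum>a\<in>arcs n. x a * c a)"
      unfolding g.sum g.scale c_def ..
    finally show ?thesis by (simp add: lin_def mult.commute)
  qed
  have gB: "g x = 0" if "x \<in> B" for x
    using that g(2) yB fv.span_base[of x B] by auto
  have "g x = 0" if "x \<in> C" for x
    using fvr.linear_eq_0_on_span[OF g(1) gB] that B(3) by blast
  then have "lin n c x = 0" if "x \<in> C" for x
    using gc[of x] supp[of x] that by simp
  moreover have "lin n c y = 1" using gc[of y] supp[of y] g(2) by simp
  ultimately show ?thesis by (rule that)
qed

lemma dim_insert_outside_span:
  assumes "finite G" "C \<subseteq> fv.span G" "y \<notin> fv.span C"
  shows "fv.dim (insert y C) = fv.dim C + 1"
proof -
  obtain B where B: "B \<subseteq> C" "fv.independent B" "C \<subseteq> fv.span B" "card B = fv.dim C"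
    using fv.basis_exists by blast
  have finB: "finite B"
    using fv.independent_span_bound[OF assms(1) B(2)] B(1) assms(2) by blast
  have sp: "fv.span B = fv.span C"
    using B(1,3) fv.span_mono fv.span_minimal[OF B(3) fv.subspace_span] by blast
  then have yB: "y \<notin> fv.span B" using assms(3) by simp
  then have "y \<notin> B" using fv.span_base by blast
  moreover have "fv.independent (insert y B)" using B(2) yB fv.independent_insertI by blast
  moreover have "fv.span (insert y B) = fv.span (insert y C)"
    using sp by (simp add: fv.span_insert)
  ultimately show ?thesis
    using fv.dim_eq_card[of "insert y B" "insert y C"] finB B(4) by simp
qed

lemma dim_mono_finite:
  assumes "finite G" "D \<subseteq> fv.span G" "C \<subseteq> D"
  shows "fv.dim C \<le> fv.dim D"
proof -
  obtain A where A: "A \<subseteq> C" "fv.independent A" "C \<subseteq> fv.span A" "card A = fv.dim C"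
    using fv.basis_exists by blast
  obtain B where B: "B \<subseteq> D" "fv.independent B" "D \<subseteq> fv.span B" "card B = fv.dim D"
    using fv.basis_exists by blast
  have "finite B"
    using fv.independent_span_bound[OF assms(1) B(2)] B(1) assms(2) by blast
  moreover have "A \<subseteq> fv.span B" using A(1) B(3) assms(3) by blast
  ultimately have "card A \<le> card B" using fv.independent_span_bound A(2) by blast
  then show ?thesis using A(4) B(4) by simp
qed

section \<open>Paths as lists of inner nodes\<close>

fun wsum :: "vec \<Rightarrow> nat list \<Rightarrow> real" where
  "wsum c (x # y # zs) = c (x, y) + wsum c (y # zs)"
| "wsum c _ = 0"

text \<open>For \<open>2 \<le> p\<close> no arc condition is left: \<open>D\<close> contains every
  arc that a sequence of distinct inner nodes between \<open>0\<close> and \<open>n\<close> can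
  use.\<close>

definition mids :: "nat \<Rightarrow> nat \<Rightarrow> nat list set" where
  "mids n p = {xs. distinct xs \<and> set xs \<subseteq> {0<..<n} \<and> length xs = p - 1}"

abbreviation stpath :: "nat \<Rightarrow> nat list \<Rightarrow> nat list" where
  "stpath n xs \<equiv> 0 # xs @ [n]"

lemma finite_mids: "finite (mids n p)"
proof (rule finite_subset)
  show "mids n p \<subseteq> {xs. set xs \<subseteq> {0<..<n} \<and> length xs = p - 1}" by (auto simp: mids_def)
qed (rule finite_lists_length_eq, simp)

lemma pPaths_eq:
  assumes "2 \<le> p" "0 < n"
  shows "{vs. is_pPath n p vs} = stpath n ` mids n p"
proof (intro set_eqI iffI)
  fix vs assume "vs \<in> {vs. is_pPath n p vs}"
  then have vs: "length vs = p + 1" "distinct vs" "hd vs = 0" "last vs = n"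
    and arc: "\<And>k. k < p \<Longrightarrow> (vs ! k, vs ! Suc k) \<in> arcs n"
    by (auto simp: is_pPath_def)
  define xs where "xs = butlast (tl vs)"
  have ne: "vs \<noteq> []" "tl vs \<noteq> []" using vs(1) assms by (auto simp: Suc_le_eq length_0_conv[symmetric] simp del: length_0_conv)
  have eq: "vs = stpath n xs"
    using ne vs(3,4) by (metis append_butlast_last_id last_tl list.collapse xs_def)
  have "v \<le> n" if v: "v \<in> set vs" for v
  proof -
    obtain k where "k < length vs" "v = vs ! k"
      using v by (auto simp: in_set_conv_nth)
    moreover from this have "k \<le> p" using vs(1) by simp
    ultimately show ?thesis
      using arc[of k] arc[of "k - 1"] assms by (cases "k < p") (auto simp: arcs_def Vn_def)
  qed
  moreover have "set xs \<subseteq> set vs" "0 \<notin> set xs" "n \<notin> set xs" using vs(2) unfolding eq by auto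
  ultimately have "set xs \<subseteq> {0<..<n}"
    by (metis bot_nat_0.not_eq_extremum greaterThanLessThan_iff le_neq_implies_less subset_iff)
  then show "vs \<in> stpath n ` mids n p" using vs(1,2) eq by (auto simp: mids_def)
next
  fix vs assume "vs \<in> stpath n ` mids n p"
  then obtain xs where xs: "vs = stpath n xs" "distinct xs" "set xs \<subseteq> {0<..<n}" "length xs = p - 1"
    by (auto simp: mids_def)
  have len: "length vs = p + 1" and d: "distinct vs" and le: "\<And>v. v \<in> set vs \<Longrightarrow> v \<le> n"
    using xs assms by auto
  have 0: "vs ! 0 = 0" and n: "vs ! p = n" using xs(1,4) assms by (auto simp: nth_append)
  have "(vs ! k, vs ! Suc k) \<in> arcs n" if "k < p" for k
  proof -
    have eq: "vs ! i = vs ! j \<longleftrightarrow> i = j" if "i \<le> p" "j \<le> p" for i j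
      using d len that by (simp add: nth_eq_iff_index_eq)
    have "vs ! k \<noteq> vs ! Suc k" "vs ! Suc k \<noteq> vs ! 0" "vs ! k \<noteq> vs ! p"
      "\<not> (vs ! k = vs ! 0 \<and> vs ! Suc k = vs ! p)"
      using that assms by (auto simp: eq)
    then show ?thesis using le that len by (auto simp: arcs_def Vn_def 0 n)
  qed
  then show "vs \<in> {vs. is_pPath n p vs}"
    using len d xs(1) by (simp add: is_pPath_def)
qed

lemma path_arcs_Cons: "path_arcs (x # y # zs) = insert (x, y) (path_arcs (y # zs))"
  by (simp add: path_arcs_def)

lemma path_arcs_subset: "path_arcs vs \<subseteq> set vs \<times> set vs"
proof (cases vs)
  case (Cons x xs)
  then show ?thesis by (auto simp: path_arcs_def dest: set_zip_leftD set_zip_rightD)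
qed (simp add: path_arcs_def)

text \<open>Incidence vectors ignore multiplicities while \<open>wsum\<close> counts them; distinct
  nodes make the two sums agree.\<close>

lemma sum_incidence:
  assumes "finite A" "distinct vs" "path_arcs vs \<subseteq> A"
  shows "(\<Sum>a\<in>A. c a * incidence vs a) = wsum c vs"
proof -
  have "(\<Sum>a\<in>A. c a * incidence vs a) = (\<Sum>a\<in>path_arcs vs. c a)"
    using assms by (auto simp: incidence_def sum.If_cases Int_absorb1 if_distrib cong: if_cong)
  also have "\<dots> = wsum c vs"
    using assms(2)
  proof (induction c vs rule: wsum.induct)
    case (1 c x y zs)
    have "(x, y) \<notin> path_arcs (y # zs)" using path_arcs_subset[of "y # zs"] 1(2) by auto
    moreover have "finite (path_arcs (y # zs))" by (simp add: path_arcs_def)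
    ultimately show ?case using 1 by (simp add: path_arcs_Cons)
  qed (simp_all add: path_arcs_def)
  finally show ?thesis .
qed

lemma path_arcs_in_arcs:
  assumes "is_pPath n p vs"
  shows "path_arcs vs \<subseteq> arcs n"
  using assms unfolding is_pPath_def path_arcs_def set_zip by (auto simp: nth_tl)

lemma wsum_Cons_append:
  "W \<noteq> [] \<Longrightarrow> wsum c (a # W @ b # ys) = c (a, hd W) + wsum c W + c (last W, b) + wsum c (b # ys)"
proof (induction W arbitrary: a)
  case (Cons w W)
  then show ?case by (cases W) auto
qed simp

lemma wsum_linear: "wsum (\<lambda>a. r * c a + s * d a) xs = r * wsum c xs + s * wsum d xs"
  by (induction c xs rule: wsum.induct) (auto simp: algebra_simps)

text \<open>Node terms telescope, so a potential changes the cost of all paths with the same ends by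
  one constant. This is the freedom used to normalise functionals.\<close>

lemma wsum_potential:
  "wsum (\<lambda>(i, j). c (i, j) - \<pi> i + \<pi> j) (x # xs) = wsum c (x # xs) - \<pi> x + \<pi> (last (x # xs))"
  by (induction xs arbitrary: x) auto

lemma wsum_const: "wsum (\<lambda>_. \<mu>) (x # xs) = \<mu> * real (length xs)"
  by (induction xs arbitrary: x) (auto simp: algebra_simps)

lemma wsum_cong:
  assumes "\<And>a. a \<in> path_arcs xs \<Longrightarrow> c a = d a"
  shows "wsum c xs = wsum d xs"
  using assms by (induction c xs rule: wsum.induct) (auto simp: path_arcs_Cons)

lemma wsum_nonneg:
  assumes "\<And>a. 0 \<le> c a"
  shows "0 \<le> wsum c xs"
  using assms by (induction c xs rule: wsum.induct) auto

section \<open>Criteria for and against facets of the path polytope\<close>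

locale path_polytope =
  fixes n p :: nat
  assumes p4: "4 \<le> p" and pn: "p \<le> n - 1"
begin

abbreviation "P \<equiv> pathPolytope n p"
abbreviation "pvec xs \<equiv> incidence (stpath n xs)"

lemma n5: "5 \<le> n" using p4 pn by simp

lemma pPath_stpath: "xs \<in> mids n p \<Longrightarrow> is_pPath n p (stpath n xs)"
  using pPaths_eq[of p n] p4 n5 by auto

lemma P_eq: "P = convhull (pvec ` mids n p)"
  using pPaths_eq[of p n] p4 n5 by (simp add: pathPolytope_def image_image)

lemma lin_pvec:
  assumes "xs \<in> mids n p"
  shows "lin n c (pvec xs) = wsum c (stpath n xs)"
proof -
  have "distinct (stpath n xs)" using pPath_stpath[OF assms] by (simp only: is_pPath_def)
  then show ?thesis
    unfolding lin_def
    using sum_incidence[OF finite_arcs] path_arcs_in_arcs[OF pPath_stpath[OF assms]] by blast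
qed

lemma pvec_in_P:
  assumes "xs \<in> mids n p"
  shows "pvec xs \<in> P"
  unfolding P_eq convhull_def using assms
  by (auto intro!: exI[of _ "{pvec xs}"] exI[of _ "\<lambda>_. 1"])

lemma P_E:
  assumes "x \<in> P"
  obtains F w where "finite F" "F \<subseteq> pvec ` mids n p" "\<forall>v\<in>F. 0 \<le> w v"
    "(\<Sum>v\<in>F. w v) = 1" "x = (\<lambda>a. \<Sum>v\<in>F. w v * v a)"
  using assms unfolding P_eq convhull_def by blast

text \<open>Every path leaves \<open>0\<close> exactly once, so constants can be written as linear
  functionals on the polytope.\<close>

lemma lin_source:
  assumes "x \<in> P"
  shows "lin n (\<lambda>(i, j). if i = 0 then 1 else 0) x = 1"
proof -
  have pv: "lin n (\<lambda>(i, j). if i = 0 then 1 else 0) (pvec xs) = 1" if "xs \<in> mids n p" for xs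
  proof -
    have z: "wsum (\<lambda>(i, j). if i = 0 then 1 else 0) ys = 0" if "0 \<notin> set ys" for ys
      using that by (induction "(\<lambda>(i, j). if i = 0 then 1 else 0) :: vec" ys rule: wsum.induct) auto
    have "xs \<noteq> []" "0 \<notin> set (xs @ [n])" using that p4 n5 by (auto simp: mids_def)
    then show ?thesis using z[of "xs @ [n]"] lin_pvec[OF that] by (cases xs) auto
  qed
  obtain F w where F: "finite F" "F \<subseteq> pvec ` mids n p" "\<forall>v\<in>F. 0 \<le> w v"
    "(\<Sum>v\<in>F. w v) = 1" "x = (\<lambda>a. \<Sum>v\<in>F. w v * v a)"
    by (rule P_E[OF assms]) (rule that)
  have "lin n (\<lambda>(i, j). if i = 0 then 1 else 0) v = 1" if "v \<in> F" for v
    using pv F(2) that by auto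
  then show ?thesis using F(4) by (simp add: F(5) lin_sum)
qed

lemma P_span: "P \<subseteq> fv.span (pvec ` mids n p)"
proof
  fix x assume "x \<in> P"
  then obtain F w where F: "finite F" "F \<subseteq> pvec ` mids n p" "\<forall>v\<in>F. 0 \<le> w v"
    "(\<Sum>v\<in>F. w v) = 1" "x = (\<lambda>a. \<Sum>v\<in>F. w v * v a)"
    by (rule P_E) (rule that)
  have "x = (\<Sum>v\<in>F. vscale (w v) v)"
    unfolding F(5) by (rule ext) (simp add: sum_vec_apply vscale_def)
  also have "\<dots> \<in> fv.span (pvec ` mids n p)"
    using F(2) by (intro fv.span_sum fv.span_scale fv.span_base) auto
  finally show "x \<in> fv.span (pvec ` mids n p)" .
qed

lemma P_support: "x \<in> P \<Longrightarrow> a \<notin> arcs n \<Longrightarrow> x a = 0"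
proof -
  assume x: "x \<in> P" and a: "a \<notin> arcs n"
  obtain F w where F: "finite F" "F \<subseteq> pvec ` mids n p" "\<forall>v\<in>F. 0 \<le> w v"
    "(\<Sum>v\<in>F. w v) = 1" "x = (\<lambda>a. \<Sum>v\<in>F. w v * v a)"
    by (rule P_E[OF x]) (rule that)
  have "v a = 0" if "v \<in> F" for v
    using that F(2) a pPath_stpath path_arcs_in_arcs by (fastforce simp: incidence_def)
  then have "\<forall>v\<in>F. w v * v a = 0" by (metis mult_zero_right)
  then show "x a = 0" unfolding F(5) by (rule sum.neutral)
qed

lemma valid_ineq_lin_iff:
  "valid_ineq P (lin n f) b \<longleftrightarrow> (\<forall>xs\<in>mids n p. wsum f (stpath n xs) \<le> b)"
proof
  assume v: "\<forall>xs\<in>mids n p. wsum f (stpath n xs) \<le> b"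
  show "valid_ineq P (lin n f) b"
    unfolding valid_ineq_def
  proof
    fix x assume "x \<in> P"
    then obtain F w where F: "finite F" "F \<subseteq> pvec ` mids n p" "\<forall>v\<in>F. 0 \<le> w v"
    "(\<Sum>v\<in>F. w v) = 1" "x = (\<lambda>a. \<Sum>v\<in>F. w v * v a)"
      by (rule P_E) (rule that)
    have "lin n f v \<le> b" if "v \<in> F" for v using that F(2) v lin_pvec by auto
    then have "(\<Sum>v\<in>F. w v * lin n f v) \<le> (\<Sum>v\<in>F. w v * b)"
      using F(3) by (intro sum_mono mult_left_mono) auto
    then show "lin n f x \<le> b" using F(4) by (simp add: F(5) lin_sum flip: sum_distrib_right)
  qed
qed (auto simp: valid_ineq_def dest: pvec_in_P simp flip: lin_pvec)

text \<open>In a convex combination lying on the face the weighted slacks are nonnegative and add up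
  to zero, so every vertex of positive weight is tight.\<close>

lemma face_functional_zero:
  assumes "\<And>xs. xs \<in> mids n p \<Longrightarrow> wsum f (stpath n xs) \<le> b"
    and "\<And>xs. xs \<in> mids n p \<Longrightarrow> wsum f (stpath n xs) = b \<Longrightarrow> wsum c (stpath n xs) = 0"
    and "x \<in> P" "lin n f x = b"
  shows "lin n c x = 0"
proof -
  obtain F w where F: "finite F" "F \<subseteq> pvec ` mids n p" "\<forall>v\<in>F. 0 \<le> w v"
    "(\<Sum>v\<in>F. w v) = 1" "x = (\<lambda>a. \<Sum>v\<in>F. w v * v a)"
    by (rule P_E[OF assms(3)]) (rule that)
  have le: "lin n f v \<le> b" if "v \<in> F" for v using that F(2) assms(1) lin_pvec by auto
  have "(\<Sum>v\<in>F. w v * (b - lin n f v)) = b - lin n f x"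
    using F(4) by (simp add: F(5) lin_sum right_diff_distrib sum_subtractf flip: sum_distrib_right)
  then have "(\<Sum>v\<in>F. w v * (b - lin n f v)) = 0" using assms(4) by simp
  then have "\<forall>v\<in>F. w v * (b - lin n f v) = 0"
    using F(1,3) le by (subst (asm) sum_nonneg_eq_0_iff) auto
  moreover have "lin n c v = 0" if "v \<in> F" "lin n f v = b" for v
    using that F(2) assms(2) lin_pvec by auto
  ultimately have "\<forall>v\<in>F. w v * lin n c v = 0" by fastforce
  then show ?thesis unfolding F(5) lin_sum by (rule sum.neutral)
qed

lemma pdim_subset: "C \<subseteq> P \<Longrightarrow> pdim C = int (fv.dim C) - 1"
  using pdim_eq_dim[of C n "\<lambda>(i, j). if i = 0 then 1 else 0" "pvec ` mids n p"]
    lin_source P_span finite_mids by blast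

text \<open>Adjoining one non-tight path to the face spans everything: otherwise some functional
  vanishes on the face and at \<open>x0\<close> but not on all paths. It is \<open>l\<close> times
  the slack, and the slack at \<open>x0\<close> is nonzero, so \<open>l = 0\<close>, a
  contradiction.\<close>

lemma facet_definingI:
  assumes le: "\<And>xs. xs \<in> mids n p \<Longrightarrow> wsum f (stpath n xs) \<le> b"
    and x0: "x0 \<in> mids n p" "wsum f (stpath n x0) \<noteq> b"
    and dual: "\<And>c. (\<And>xs. xs \<in> mids n p \<Longrightarrow> wsum f (stpath n xs) = b \<Longrightarrow> wsum c (stpath n xs) = 0)
      \<Longrightarrow> \<exists>l. \<forall>xs\<in>mids n p. wsum c (stpath n xs) = l * (wsum f (stpath n xs) - b)"
  shows "facet_defining P (lin n f) b"
proof -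
  define F where "F = {x\<in>P. lin n f x = b}"
  let ?h = "\<lambda>(i, j). if i = 0 then 1 else 0 :: real"
  \<comment> \<open>The affine function \<open>f - b\<close>, made linear by attaching
    \<open>b\<close> to the arcs that leave \<open>0\<close>.\<close>
  let ?g = "\<lambda>a. f a - b * ?h a"
  have FP: "F \<subseteq> P" by (auto simp: F_def)
  have x0P: "pvec x0 \<in> P" using x0(1) by (rule pvec_in_P)
  have g: "lin n ?g x = lin n f x - b" if "x \<in> P" for x
    using lin_source[OF that] by (simp only: lin_diff_coeffs)
  have out: "pvec x0 \<notin> fv.span F"
  proof
    assume "pvec x0 \<in> fv.span F"
    then have "lin n ?g (pvec x0) = 0"
      by (rule lin_span_zero) (use g in \<open>auto simp: F_def\<close>)
    then show False using g[OF x0P] x0 by (simp add: lin_pvec)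
  qed
  have "pvec xs \<in> fv.span (insert (pvec x0) F)" if xs: "xs \<in> mids n p" for xs
  proof (rule ccontr)
    assume "pvec xs \<notin> fv.span (insert (pvec x0) F)"
    moreover have "x a = 0" if "x \<in> insert (pvec xs) (insert (pvec x0) F)" "a \<notin> arcs n" for x a
      using P_support[OF _ that(2)] that(1) pvec_in_P[OF xs] x0P FP by blast
    ultimately obtain c where c: "\<And>x. x \<in> insert (pvec x0) F \<Longrightarrow> lin n c x = 0" "lin n c (pvec xs) = 1"
      using separating_functional by blast
    have "wsum c (stpath n ys) = 0" if "ys \<in> mids n p" "wsum f (stpath n ys) = b" for ys
      using c(1)[of "pvec ys"] that pvec_in_P lin_pvec by (auto simp: F_def)
    from dual[OF this] obtain l where
      l: "\<forall>ys\<in>mids n p. wsum c (stpath n ys) = l * (wsum f (stpath n ys) - b)" by blast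
    have "l = 0" using l x0 c(1)[of "pvec x0"] lin_pvec by auto
    then show False using l xs c(2) lin_pvec by auto
  qed
  then have "pvec ` mids n p \<subseteq> fv.span (insert (pvec x0) F)" by blast
  then have "fv.span (pvec ` mids n p) \<subseteq> fv.span (insert (pvec x0) F)"
    by (rule fv.span_minimal) (rule fv.subspace_span)
  then have "P \<subseteq> fv.span (insert (pvec x0) F)" using P_span by blast
  moreover have "insert (pvec x0) F \<subseteq> P" using x0P FP by blast
  ultimately have "fv.span P = fv.span (insert (pvec x0) F)"
    using fv.span_mono fv.span_minimal[OF _ fv.subspace_span] by blast
  then have "fv.dim P = fv.dim (insert (pvec x0) F)" by (rule fv.span_eq_dim)
  also have "\<dots> = fv.dim F + 1"
    by (rule dim_insert_outside_span[OF _ order_trans[OF FP P_span] out]) (simp add: finite_mids)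
  finally show ?thesis
    using le valid_ineq_lin_iff pdim_subset[of P] pdim_subset[of F] FP
    by (simp add: facet_defining_def F_def)
qed

text \<open>The functionals are used triangularly: \<open>c1\<close> separates \<open>y1\<close>
  from the span of the face, and \<open>c2\<close>, which is zero at \<open>y1\<close> too,
  separates \<open>y2\<close> from the enlarged span. The dimension thus grows at least
  twice.\<close>

lemma not_facet_definingI:
  assumes le: "\<And>xs. xs \<in> mids n p \<Longrightarrow> wsum f (stpath n xs) \<le> b"
    and c1: "\<And>xs. xs \<in> mids n p \<Longrightarrow> wsum f (stpath n xs) = b \<Longrightarrow> wsum c1 (stpath n xs) = 0"
    and c2: "\<And>xs. xs \<in> mids n p \<Longrightarrow> wsum f (stpath n xs) = b \<Longrightarrow> wsum c2 (stpath n xs) = 0"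
    and y1: "y1 \<in> mids n p" "wsum c1 (stpath n y1) \<noteq> 0" "wsum c2 (stpath n y1) = 0"
    and y2: "y2 \<in> mids n p" "wsum c2 (stpath n y2) \<noteq> 0"
  shows "\<not> facet_defining P (lin n f) b"
proof -
  define F where "F = {x\<in>P. lin n f x = b}"
  have FP: "F \<subseteq> P" by (auto simp: F_def)
  have F: "x \<in> P" "lin n f x = b" if "x \<in> F" for x using that by (simp_all add: F_def)
  have c1F: "lin n c1 x = 0" if "x \<in> F" for x
    by (rule face_functional_zero[OF le c1 F[OF that]])
  have c2F: "lin n c2 x = 0" if "x \<in> F" for x
    by (rule face_functional_zero[OF le c2 F[OF that]])
  have o1: "pvec y1 \<notin> fv.span F"
  proof
    assume "pvec y1 \<in> fv.span F"
    then have "lin n c1 (pvec y1) = 0" using c1F by (rule lin_span_zero)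
    then show False using y1 lin_pvec by simp
  qed
  have o2: "pvec y2 \<notin> fv.span (insert (pvec y1) F)"
  proof
    assume "pvec y2 \<in> fv.span (insert (pvec y1) F)"
    then have "lin n c2 (pvec y2) = 0"
      by (rule lin_span_zero) (use y1 lin_pvec c2F in auto)
    then show False using y2 lin_pvec by simp
  qed
  have sub: "insert (pvec y2) (insert (pvec y1) F) \<subseteq> P"
    using FP y1(1) y2(1) pvec_in_P by blast
  have fin: "finite (pvec ` mids n p)" using finite_mids by blast
  have "fv.dim (insert (pvec y2) (insert (pvec y1) F)) = fv.dim F + 1 + 1"
    using dim_insert_outside_span[OF fin order_trans[OF FP P_span] o1]
      dim_insert_outside_span[OF fin order_trans[OF _ P_span] o2] sub
    by simp
  moreover have "fv.dim (insert (pvec y2) (insert (pvec y1) F)) \<le> fv.dim P"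
    using dim_mono_finite[OF fin P_span sub] .
  ultimately show ?thesis
    using pdim_subset[of P] pdim_subset[OF FP] by (simp add: facet_defining_def F_def)
qed

end

section \<open>Paths through one arc that avoid another\<close>

lemma path_arcs_singleton [simp]: "path_arcs [x] = {}" "path_arcs [] = {}"
  by (simp_all add: path_arcs_def)

lemma path_arcs_append: "path_arcs (xs @ a # ys) = path_arcs (xs @ [a]) \<union> path_arcs (a # ys)"
proof (induction xs)
  case (Cons x xs)
  then show ?case by (cases xs) (simp_all add: path_arcs_Cons)
qed simp

lemma path_arcs_butlast_tl: "path_arcs vs \<subseteq> set (butlast vs) \<times> set (tl vs)"
proof (induction vs)
  case (Cons x xs)
  then show ?case by (cases xs) (auto simp: path_arcs_Cons dest: list.set_sel(2))
qed simp

lemma ex_distinct_list: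
  assumes "finite Y" "k \<le> card Y"
  shows "\<exists>ys. distinct ys \<and> set ys \<subseteq> Y \<and> length ys = k"
proof -
  obtain Z where "Z \<subseteq> Y" "card Z = k" "finite Z"
    using obtain_subset_with_card_n[OF assms(2)] by metis
  then show ?thesis using finite_distinct_list[of Z] distinct_card by metis
qed

lemma ex_two_elements:
  assumes "2 \<le> card A"
  shows "\<exists>x\<in>A. \<exists>y\<in>A. x \<noteq> y"
proof -
  have "finite A" using assms by (metis card.infinite not_numeral_le_zero)
  then show ?thesis using assms card_le_Suc0_iff_eq[of A] by auto
qed

lemma in_path_arcs_iff_wsum:
  assumes "distinct vs"
  shows "wsum (\<lambda>a'. if a' = a then 1 else 0) vs = (if a \<in> path_arcs vs then 1 else 0)"
proof -
  have "wsum (\<lambda>a'. if a' = a then 1 else 0) vs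
      = (\<Sum>a'\<in>path_arcs vs. (if a' = a then 1 else 0) * incidence vs a')"
    using sum_incidence[of "path_arcs vs" vs] assms by (simp add: path_arcs_def)
  also have "\<dots> = (\<Sum>a'\<in>path_arcs vs. if a' = a then 1 else 0)"
    by (intro sum.cong) (auto simp: incidence_def)
  finally show ?thesis by (simp add: path_arcs_def)
qed

context path_polytope
begin

lemma distinct_stpath: "xs \<in> mids n p \<Longrightarrow> distinct (stpath n xs)"
  using n5 by (auto simp: mids_def)

lemma arcs_cases:
  assumes "(i, j) \<in> arcs n"
  obtains "i = 0" "j \<in> {0<..<n}" | "i \<in> {0<..<n}" "j = n" | "i \<in> {0<..<n}" "j \<in> {0<..<n}" "i \<noteq> j"
proof -
  have "i \<le> n" "j \<le> n" "i \<noteq> j" "j \<noteq> 0" "i \<noteq> n" "\<not> (i = 0 \<and> j = n)"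
    using assms by (auto simp: arcs_def Vn_def)
  then show ?thesis using that by (cases "i = 0"; cases "j = n") auto
qed

text \<open>Since \<open>p - 1 < n - 1\<close>, one inner node can be left out. If \<open>a'\<close>
  has an inner end that is not an end of \<open>a\<close>, leaving out that node suffices; otherwise
  \<open>a'\<close> is avoided through the place that \<open>a\<close> gets on the path.\<close>

lemma ex_path_arc_avoiding_arc:
  assumes a: "a \<in> arcs n" and a': "a' \<in> arcs n" and ne: "a \<noteq> a'"
  shows "\<exists>xs\<in>mids n p. a \<in> path_arcs (stpath n xs) \<and> a' \<notin> path_arcs (stpath n xs)"
proof -
  obtain i j where ij: "a = (i, j)" by fastforce
  obtain k l where kl: "a' = (k, l)" by fastforce
  obtain Y where Y: "Y \<subseteq> {0<..<n} - {i, j}" "card Y \<le> 1"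
    "Y \<noteq> {} \<and> Y \<subseteq> {k, l} \<or> Y = {} \<and> k \<in> {0, i, j} \<and> l \<in> {n, i, j}"
  proof (cases "k \<in> {0<..<n} - {i, j}")
    case True
    then show ?thesis using that[of "{k}"] by auto
  next
    case k: False
    show ?thesis
    proof (cases "l \<in> {0<..<n} - {i, j}")
      case True
      then show ?thesis using that[of "{l}"] by auto
    next
      case False
      then show ?thesis using that[of "{}"] k a' kl by (auto simp: arcs_def Vn_def)
    qed
  qed
  have finY: "finite Y" using Y(1) finite_subset by blast
  have avoid: "a' \<notin> path_arcs (stpath n xs)" if "Y \<noteq> {}" "set xs \<inter> Y = {}" for xs
  proof
    assume "a' \<in> path_arcs (stpath n xs)"
    then have "{k, l} \<subseteq> set (stpath n xs)" using path_arcs_subset kl by blast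
    then show False using that Y(1,3) by fastforce
  qed
  have list: "\<exists>ys. distinct ys \<and> set ys \<subseteq> {0<..<n} - A - Y \<and> length ys = q"
    if "q + card A + 1 \<le> n - 1" "finite A" for q A
  proof (rule ex_distinct_list)
    have "card {0<..<n} - card A - card Y \<le> card ({0<..<n} - A - Y)"
      using diff_card_le_card_Diff[of A "{0<..<n}"] diff_card_le_card_Diff[of Y "{0<..<n} - A"] that finY
      by linarith
    then show "q \<le> card ({0<..<n} - A - Y)" using that Y(2) by simp
  qed simp
  from a have "(i, j) \<in> arcs n" unfolding ij .
  then show ?thesis
  proof (cases rule: arcs_cases)
    case 1
    obtain ys where ys: "distinct ys" "set ys \<subseteq> {0<..<n} - {j} - Y" "length ys = p - 2"
    proof -
      have "p - 2 + card {j} + 1 \<le> n - 1" using p4 pn by simp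
      then show ?thesis using list[of "p - 2" "{j}"] that by blast
    qed
    have M: "j # ys \<in> mids n p" using ys 1 p4 by (auto simp: mids_def)
    obtain y zs where yz: "ys = y # zs" using ys(3) p4 by (cases ys) auto
    have "a' \<notin> path_arcs (stpath n (j # ys))"
    proof (cases "Y = {}")
      case False
      then show ?thesis using avoid[of "j # ys"] Y(1) ys(2) by fastforce
    next
      case True
      then have "k \<in> {0, j}" "l \<in> {n, j}" using Y(3) 1 a' kl by (auto simp: arcs_def)
      then show ?thesis
        using ne ys 1 path_arcs_butlast_tl[of "y # zs @ [n]"] unfolding kl ij yz
        by (fastforce simp: path_arcs_Cons butlast_append)
    qed
    then show ?thesis using M 1 by (intro bexI[of _ "j # ys"]) (auto simp: path_arcs_Cons ij)
  next
    case 2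
    obtain ys where ys: "distinct ys" "set ys \<subseteq> {0<..<n} - {i} - Y" "length ys = p - 2"
    proof -
      have "p - 2 + card {i} + 1 \<le> n - 1" using p4 pn by simp
      then show ?thesis using list[of "p - 2" "{i}"] that by blast
    qed
    have M: "ys @ [i] \<in> mids n p" using ys 2 p4 by (auto simp: mids_def)
    obtain y zs where yz: "ys = y # zs" using ys(3) p4 by (cases ys) auto
    have eq: "path_arcs (stpath n (ys @ [i])) = insert (i, n) (insert (0, y) (path_arcs (y # zs @ [i])))"
      using path_arcs_append[of "0 # y # zs" i "[n]"] unfolding yz by (simp add: path_arcs_Cons)
    have "a' \<notin> path_arcs (stpath n (ys @ [i]))"
    proof (cases "Y = {}")
      case False
      then show ?thesis using avoid[of "ys @ [i]"] Y(1) ys(2) by fastforce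
    next
      case True
      then have "k \<in> {0, i}" "l \<in> {n, i}" using Y(3) 2 a' kl by (auto simp: arcs_def)
      then show ?thesis
        using ne ys[unfolded yz] 2 path_arcs_butlast_tl[of "y # zs @ [i]"] unfolding kl ij eq
        by (fastforce simp: butlast_append)
    qed
    then show ?thesis using M eq 2 by (intro bexI[of _ "ys @ [i]"]) (auto simp: ij)
  next
    case 3
    obtain ys where ys: "distinct ys" "set ys \<subseteq> {0<..<n} - {i, j} - Y" "length ys = p - 3"
    proof -
      have "p - 3 + card {i, j} + 1 \<le> n - 1" using p4 pn 3 by simp
      then show ?thesis using list[of "p - 3" "{i, j}"] that by blast
    qed
    obtain y zs where yz: "ys = y # zs" using ys(3) p4 by (cases ys) auto
    have M1: "i # j # ys \<in> mids n p" and M2: "ys @ [i, j] \<in> mids n p"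
      using ys 3 p4 by (auto simp: mids_def)
    have eq: "path_arcs (stpath n (ys @ [i, j])) = {(i, j), (j, n), (0, y)} \<union> path_arcs (y # zs @ [i])"
      using path_arcs_append[of "0 # y # zs" i "[j, n]"] unfolding yz by (auto simp: path_arcs_Cons)
    \<comment> \<open>If \<open>a'\<close> leaves \<open>j\<close>, putting \<open>i, j\<close>
      first makes \<open>j\<close> continue to a node other than \<open>i\<close> and
      \<open>n\<close>. Any other \<open>a'\<close> that avoids no node of \<open>Y\<close> is
      missed when \<open>i, j\<close> come last.\<close>
    show ?thesis
    proof (cases "Y = {} \<and> k = j")
      case True
      then have "l \<in> {n, i, j}" using Y(3) by auto
      then have "a' \<notin> path_arcs (stpath n (i # j # ys))"
        using True ne ys 3 path_arcs_butlast_tl[of "y # zs @ [n]"] unfolding kl ij yz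
        by (fastforce simp: path_arcs_Cons butlast_append)
      then show ?thesis using M1 by (intro bexI[of _ "i # j # ys"]) (auto simp: path_arcs_Cons ij)
    next
      case False
      have "a' \<notin> path_arcs (stpath n (ys @ [i, j]))"
      proof (cases "Y = {}")
        case True
        then have "k \<in> {0, i}" "l \<in> {n, i, j}" using Y(3) False by auto
        moreover have "k \<noteq> l" "\<not> (k = 0 \<and> l = n)" using a' kl by (auto simp: arcs_def)
        ultimately show ?thesis
          using ne ys[unfolded yz] 3 path_arcs_butlast_tl[of "y # zs @ [i]"] unfolding kl ij eq
          by (fastforce simp: butlast_append)
      qed (use avoid[of "ys @ [i, j]"] Y(1) ys(2) in fastforce)
      then show ?thesis using M2 eq by (intro bexI[of _ "ys @ [i, j]"]) (auto simp: ij)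
    qed
  qed
qed

lemma ex_path_arc: "a \<in> arcs n \<Longrightarrow> \<exists>xs\<in>mids n p. a \<in> path_arcs (stpath n xs)"
proof -
  assume a: "a \<in> arcs n"
  have "(0, 1) \<in> arcs n" "(0, 2) \<in> arcs n" using n5 by (auto simp: arcs_def Vn_def)
  then obtain a' where "a' \<in> arcs n" "a \<noteq> a'" by (cases "a = (0, 1)") fastforce+
  then show ?thesis using ex_path_arc_avoiding_arc a by blast
qed

text \<open>Two vanishing variables are independent as equations because some path uses the first
  arc without the second.\<close>

lemma not_facet_definingI_two_arcs:
  assumes le: "\<And>xs. xs \<in> mids n p \<Longrightarrow> wsum f (stpath n xs) \<le> b"
    and arc: "a \<in> arcs n" "a' \<in> arcs n" "a \<noteq> a'"
    and zero: "\<And>xs. xs \<in> mids n p \<Longrightarrow> wsum f (stpath n xs) = b \<Longrightarrow>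
      a \<notin> path_arcs (stpath n xs) \<and> a' \<notin> path_arcs (stpath n xs)"
  shows "\<not> facet_defining P (lin n f) b"
proof -
  obtain y1 where y1: "y1 \<in> mids n p" "a \<in> path_arcs (stpath n y1)" "a' \<notin> path_arcs (stpath n y1)"
    using ex_path_arc_avoiding_arc arc by blast
  obtain y2 where y2: "y2 \<in> mids n p" "a' \<in> path_arcs (stpath n y2)"
    using ex_path_arc arc by blast
  note w = in_path_arcs_iff_wsum[OF distinct_stpath]
  show ?thesis
    by (rule not_facet_definingI[OF le, of "\<lambda>x. if x = a then 1 else 0" "\<lambda>x. if x = a' then 1 else 0" y1 y2])
      (use zero y1 y2 in \<open>simp_all add: w\<close>)
qed

end

section \<open>Slack of a path\<close>

lemma wsum_Nats:
  assumes "\<And>a. c a \<in> \<nat>"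
  shows "wsum c xs \<in> \<nat>"
  using assms by (induction c xs rule: wsum.induct) (auto intro: Nats_add)

lemma wsum_member_le:
  assumes "\<And>a. 0 \<le> c a" "a \<in> path_arcs xs"
  shows "c a \<le> wsum c xs"
  using assms
proof (induction c xs rule: wsum.induct)
  case (1 c x y zs)
  have "0 \<le> wsum c (y # zs)" "0 \<le> c (x, y)" using 1(2) by (simp_all add: wsum_nonneg)
  moreover have "a = (x, y) \<or> c a \<le> wsum c (y # zs)" using 1 by (auto simp: path_arcs_Cons)
  ultimately show ?case by auto
qed auto

lemma wsum_out:
  assumes "distinct xs"
  shows "wsum (\<lambda>(i, j). g i) (x # xs @ [y]) = g x + (\<Sum>v\<in>set xs. g v)"
  using assms by (induction xs arbitrary: x) auto

lemma wsum_in: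
  assumes "distinct xs"
  shows "wsum (\<lambda>(i, j). g j) (x # xs @ [y]) = g y + (\<Sum>v\<in>set xs. g v)"
  using assms by (induction xs arbitrary: x) auto

locale gmc = path_polytope +
  fixes R S T :: "nat set"
  assumes part: "R \<union> S \<union> T = Vn n" "R \<inter> S = {}" "R \<inter> T = {}" "S \<inter> T = {}"
    and endpoints: "0 \<in> T" "n \<in> T"
begin

definition fcoef :: vec where
  "fcoef = (\<lambda>(i, j). of_bool (i \<in> R \<or> i \<in> S \<and> j \<in> T))"

abbreviation "val xs \<equiv> wsum fcoef (stpath n xs)"
abbreviation "bnd \<equiv> real ((p + card R) div 2)"
definition "T' = T - {0, n}"

lemma finite_RST: "finite R" "finite S" "finite T" "finite T'"
  using part(1) finite_subset[of _ "Vn n"] by (auto simp: Vn_def T'_def)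

lemma nodes:
  "R \<subseteq> {0<..<n}" "S \<subseteq> {0<..<n}" "T' \<subseteq> {0<..<n}" "R \<union> S \<union> T' = {0<..<n}"
proof -
  have "0 \<notin> R" "n \<notin> R" "0 \<notin> S" "n \<notin> S" using part endpoints by auto
  moreover have "R \<union> S \<union> T = {0..n}" using part(1) by (simp add: Vn_def)
  moreover have "{0<..<n} = {0..n} - {0, n}" by auto
  ultimately show "R \<union> S \<union> T' = {0<..<n}" unfolding T'_def by auto
  then show "R \<subseteq> {0<..<n}" "S \<subseteq> {0<..<n}" "T' \<subseteq> {0<..<n}" by auto
qed

lemma T_eq: "T = insert 0 (insert n T')" using endpoints by (auto simp: T'_def)

lemma card_T: "card T = card T' + 2"
proof -
  have "card (insert 0 (insert n T')) = card T' + 2"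
    using n5 finite_RST nodes(3) by (subst card_insert_disjoint; auto simp: T'_def)+
  then show ?thesis using arg_cong[OF T_eq, of card] by (rule trans[rotated])
qed

lemma card_nodes: "card R + card S + card T' = n - 1"
proof -
  have "card (R \<union> S \<union> T') = card R + card S + card T'"
    using part finite_RST by (subst card_Un_disjoint card_Un_disjoint; auto simp: T'_def)+
  then show ?thesis using nodes(4) by simp
qed

text \<open>\<open>R\<close> and \<open>S\<close> are disjoint, so no arc is counted in both sums
  and 0-1 coefficients suffice.\<close>

lemma gmc_lhs_eq: "gmc_lhs n R S T = lin n fcoef"
proof
  fix x
  have "(\<Sum>i\<in>R. xsum x (delta_out n i)) = (\<Sum>a\<in>(\<Union>i\<in>R. delta_out n i). x a)"
    unfolding xsum_def
    by (rule sum.UNION_disjoint[symmetric])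
      (auto simp: delta_out_def finite_RST intro: finite_subset[OF _ finite_arcs])
  also have "(\<Union>i\<in>R. delta_out n i) = {a \<in> arcs n. fst a \<in> R}" by (auto simp: delta_out_def)
  finally have "gmc_lhs n R S T x = (\<Sum>a\<in>cut_arcs n S T. x a) + (\<Sum>a\<in>{a \<in> arcs n. fst a \<in> R}. x a)"
    by (simp add: gmc_lhs_def xsum_def)
  also have "\<dots> = (\<Sum>a\<in>cut_arcs n S T \<union> {a \<in> arcs n. fst a \<in> R}. x a)"
    using part(2) finite_arcs
    by (intro sum.union_disjoint[symmetric]) (auto simp: cut_arcs_def intro: finite_subset[OF _ finite_arcs])
  also have "\<dots> = (\<Sum>a\<in>{a \<in> arcs n. fst a \<in> R \<or> fst a \<in> S \<and> snd a \<in> T}. x a)"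
    by (rule sum.cong) (auto simp: cut_arcs_def)
  also have "\<dots> = (\<Sum>a\<in>arcs n. if fst a \<in> R \<or> fst a \<in> S \<and> snd a \<in> T then x a else 0)"
    by (rule sum.inter_filter[OF finite_arcs])
  also have "\<dots> = lin n fcoef x"
    unfolding lin_def by (rule sum.cong) (auto simp: fcoef_def)
  finally show "gmc_lhs n R S T x = lin n fcoef x" .
qed

text \<open>Marks the defects visible on arcs. Missed \<open>R\<close>-nodes, the third kind of
  defect, are counted separately.\<close>

definition sig :: vec where "sig = (\<lambda>(i, j). of_bool ((i \<in> S) \<noteq> (j \<in> T)))"

text \<open>Here \<beta> counts arcs from \<open>S\<close> to outside \<open>T\<close>, \<gamma>
  arcs into \<open>T\<close> from outside \<open>S\<close>, and \<open>k\<close> arcs from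
  \<open>S\<close> to \<open>T\<close>. The identities hold because each visited
  \<open>S\<close>-node has one outgoing arc and each visited \<open>T\<close>-node except
  \<open>0\<close> one incoming arc; the \<open>+ 1\<close> next to \<open>T'\<close> accounts for
  \<open>n\<close>.\<close>

lemma path_counts:
  assumes xs: "xs \<in> mids n p"
  obtains \<alpha> \<beta> \<gamma> k :: nat where
    "card (R - set xs) = \<alpha>" "card (S \<inter> set xs) = k + \<beta>" "card (T' \<inter> set xs) + 1 = k + \<gamma>"
    "p + \<alpha> = card R + 2 * k + \<beta> + \<gamma>" "wsum sig (stpath n xs) = real (\<beta> + \<gamma>)"
    "2 * val xs + real (\<alpha> + \<beta> + \<gamma>) = real (p + card R)"
    "\<forall>i j. (i, j) \<in> path_arcs (stpath n xs) \<longrightarrow> i \<in> S \<longrightarrow> j \<notin> T \<longrightarrow> 1 \<le> \<beta>"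
    "\<forall>i j. (i, j) \<in> path_arcs (stpath n xs) \<longrightarrow> i \<notin> S \<longrightarrow> j \<in> T \<longrightarrow> 1 \<le> \<gamma>"
proof -
  have d: "distinct xs" and sub: "set xs \<subseteq> {0<..<n}" and len: "length xs = p - 1"
    using xs by (auto simp: mids_def)
  define cb :: vec where "cb = (\<lambda>(i, j). of_bool (i \<in> S \<and> j \<notin> T))"
  define cg :: vec where "cg = (\<lambda>(i, j). of_bool (i \<notin> S \<and> j \<in> T))"
  define ck :: vec where "ck = (\<lambda>(i, j). of_bool (i \<in> S \<and> j \<in> T))"
  let ?q = "stpath n xs"
  have N: "cb a \<in> \<nat>" "cg a \<in> \<nat>" "ck a \<in> \<nat>" "0 \<le> cb a" "0 \<le> cg a" for a
    by (cases a, simp add: cb_def cg_def ck_def of_bool_def)+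
  obtain \<beta> where \<beta>: "wsum cb ?q = real \<beta>" using wsum_Nats[of cb ?q] N(1) by (auto elim: Nats_cases)
  obtain \<gamma> where \<gamma>: "wsum cg ?q = real \<gamma>" using wsum_Nats[of cg ?q] N(2) by (auto elim: Nats_cases)
  obtain k where k: "wsum ck ?q = real k" using wsum_Nats[of ck ?q] N(3) by (auto elim: Nats_cases)
  have add: "x + y = wsum c ?q"
    if "wsum c1 ?q = x" "wsum c2 ?q = y" "\<And>a. c a = c1 a + c2 a" for c c1 c2 x y
    using wsum_linear[of 1 c1 1 c2 ?q] that(1,2) by (simp add: that(3)[abs_def])
  have 0: "0 \<notin> S" "0 \<notin> R" "n \<notin> S" using nodes by auto
  have "real k + real \<beta> = wsum (\<lambda>(i, j). of_bool (i \<in> S)) ?q"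
    by (rule add[OF k \<beta>]) (auto simp: ck_def cb_def)
  also have "\<dots> = real (card (S \<inter> set xs))" using d 0 by (simp add: wsum_out Int_commute)
  finally have s: "card (S \<inter> set xs) = k + \<beta>" by linarith
  have "real k + real \<gamma> = wsum (\<lambda>(i, j). of_bool (j \<in> T)) ?q"
    by (rule add[OF k \<gamma>]) (auto simp: ck_def cg_def)
  also have "\<dots> = 1 + real (card (T \<inter> set xs))" using d endpoints by (simp add: wsum_in Int_commute)
  also have "T \<inter> set xs = T' \<inter> set xs" using sub by (auto simp: T'_def)
  finally have t: "card (T' \<inter> set xs) + 1 = k + \<gamma>" by linarith
  have "wsum (\<lambda>(i, j). of_bool (i \<in> R)) ?q + real k = wsum fcoef ?q"
    by (rule add[OF refl k]) (use part(2) in \<open>auto simp: ck_def fcoef_def\<close>)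
  moreover have "wsum (\<lambda>(i, j). of_bool (i \<in> R)) ?q = real (card (R \<inter> set xs))"
    using d 0 by (simp add: wsum_out Int_commute)
  ultimately have v: "val xs = real (card (R \<inter> set xs)) + real k" by simp
  have r: "card (R \<inter> set xs) + card (R - set xs) = card R"
    using finite_RST(1) card_Int_Diff by fastforce
  have "set xs = (R \<inter> set xs) \<union> (S \<inter> set xs) \<union> (T' \<inter> set xs)" using sub nodes(4) by blast
  moreover have "card ((R \<inter> set xs) \<union> (S \<inter> set xs) \<union> (T' \<inter> set xs))
      = card (R \<inter> set xs) + card (S \<inter> set xs) + card (T' \<inter> set xs)"
    using part by (subst card_Un_disjoint card_Un_disjoint; auto simp: T'_def)+
  ultimately have len': "card (R \<inter> set xs) + card (S \<inter> set xs) + card (T' \<inter> set xs) = p - 1"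
    using d len distinct_card by metis
  have "real \<beta> + real \<gamma> = wsum sig ?q"
    by (rule add[OF \<beta> \<gamma>]) (auto simp: cb_def cg_def sig_def)
  then have sg: "wsum sig ?q = real (\<beta> + \<gamma>)" by simp
  have b1: "1 \<le> \<beta>" if "(i, j) \<in> path_arcs ?q" "i \<in> S" "j \<notin> T" for i j
    using wsum_member_le[of cb "(i, j)" ?q] that N \<beta> by (simp add: cb_def)
  have g1: "1 \<le> \<gamma>" if "(i, j) \<in> path_arcs ?q" "i \<notin> S" "j \<in> T" for i j
    using wsum_member_le[of cg "(i, j)" ?q] that N \<gamma> by (simp add: cg_def)
  have e: "p + card (R - set xs) = card R + 2 * k + \<beta> + \<gamma>"
    using len' s t r p4 by linarith
  have "2 * val xs + real (card (R - set xs) + \<beta> + \<gamma>) = real (p + card R)"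
  proof -
    have "2 * (card (R \<inter> set xs) + k) + (card (R - set xs) + \<beta> + \<gamma>) = p + card R"
      using r e unfolding distrib_left by simp
    from arg_cong[OF this, of real] show ?thesis unfolding v by simp
  qed
  with refl s t e sg show ?thesis by (rule that) (use b1 g1 in blast)+
qed

text \<open>Nonnegative defects bound twice the value; its integrality supplies the rounding
  down.\<close>

lemma val_le: "xs \<in> mids n p \<Longrightarrow> val xs \<le> bnd"
proof -
  assume xs: "xs \<in> mids n p"
  have "val xs \<in> \<nat>" by (rule wsum_Nats) (auto simp: fcoef_def of_bool_def)
  then obtain v where v: "val xs = real v" by (auto elim: Nats_cases)
  obtain \<alpha> \<beta> \<gamma> :: nat where "2 * val xs + real (\<alpha> + \<beta> + \<gamma>) = real (p + card R)"
    by (rule path_counts[OF xs])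
  then have "2 * v \<le> p + card R" using v by linarith
  then show ?thesis using v by simp
qed

text \<open>The defects total \<open>p + |R| - 2 * val\<close>, and their least number compatible
  with parity is the remainder modulo 2.\<close>

lemma tight_iff:
  assumes "xs \<in> mids n p"
  shows "val xs = bnd \<longleftrightarrow> wsum sig (stpath n xs) + real (card (R - set xs)) = real ((p + card R) mod 2)"
proof -
  obtain \<alpha> \<beta> \<gamma> :: nat where *: "card (R - set xs) = \<alpha>" "wsum sig (stpath n xs) = real (\<beta> + \<gamma>)"
    "2 * val xs + real (\<alpha> + \<beta> + \<gamma>) = real (p + card R)"
    by (rule path_counts[OF assms])
  have "real (p + card R) = 2 * bnd + real ((p + card R) mod 2)"
    by (metis mult_div_mod_eq of_nat_add of_nat_mult of_nat_numeral)
  then show ?thesis using * by auto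
qed

lemma tight_counts:
  assumes xs: "xs \<in> mids n p" and tight: "val xs = bnd"
  obtains \<alpha> \<beta> \<gamma> k :: nat where
    "\<alpha> + \<beta> + \<gamma> = (p + card R) mod 2"
    "card (R - set xs) = \<alpha>" "card (S \<inter> set xs) = k + \<beta>" "card (T' \<inter> set xs) + 1 = k + \<gamma>"
    "p + \<alpha> = card R + 2 * k + \<beta> + \<gamma>"
    "\<forall>i j. (i, j) \<in> path_arcs (stpath n xs) \<longrightarrow> i \<in> S \<longrightarrow> j \<notin> T \<longrightarrow> 1 \<le> \<beta>"
    "\<forall>i j. (i, j) \<in> path_arcs (stpath n xs) \<longrightarrow> i \<notin> S \<longrightarrow> j \<in> T \<longrightarrow> 1 \<le> \<gamma>"
proof (rule path_counts[OF xs])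
  fix \<alpha> \<beta> \<gamma> k :: nat
  assume *: "card (R - set xs) = \<alpha>" "card (S \<inter> set xs) = k + \<beta>" "card (T' \<inter> set xs) + 1 = k + \<gamma>"
    "p + \<alpha> = card R + 2 * k + \<beta> + \<gamma>" "wsum sig (stpath n xs) = real (\<beta> + \<gamma>)"
    "2 * val xs + real (\<alpha> + \<beta> + \<gamma>) = real (p + card R)"
    "\<forall>i j. (i, j) \<in> path_arcs (stpath n xs) \<longrightarrow> i \<in> S \<longrightarrow> j \<notin> T \<longrightarrow> 1 \<le> \<beta>"
    "\<forall>i j. (i, j) \<in> path_arcs (stpath n xs) \<longrightarrow> i \<notin> S \<longrightarrow> j \<in> T \<longrightarrow> 1 \<le> \<gamma>"
  have "real (\<beta> + \<gamma>) + real \<alpha> = real ((p + card R) mod 2)"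
    using tight *(1,5) tight_iff[OF xs] by simp
  then have "\<alpha> + \<beta> + \<gamma> = (p + card R) mod 2" by linarith
  then show thesis using *(1-4,7,8) by (rule that)
qed

end

section \<open>Necessity\<close>

context gmc
begin

abbreviation "facet \<equiv> facet_defining P (lin n fcoef) bnd"

lemma arcs_iff: "(i, j) \<in> arcs n \<longleftrightarrow> i \<le> n \<and> j \<le> n \<and> i \<noteq> j \<and> j \<noteq> 0 \<and> i \<noteq> n \<and> \<not> (i = 0 \<and> j = n)"
  by (auto simp: arcs_def Vn_def)

lemma in_class: "v \<in> R \<Longrightarrow> 0 < v \<and> v < n \<and> v \<notin> S \<and> v \<notin> T" "v \<in> S \<Longrightarrow> 0 < v \<and> v < n \<and> v \<notin> R \<and> v \<notin> T"
  "v \<in> T' \<Longrightarrow> 0 < v \<and> v < n \<and> v \<notin> R \<and> v \<notin> S \<and> v \<in> T"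
  using nodes(1-3) part by (auto simp: T'_def)

lemma endpoints_class: "0 \<notin> R" "0 \<notin> S" "n \<notin> R" "n \<notin> S"
  using nodes by auto

lemma not_facet_two_arcs:
  assumes "a \<in> arcs n" "a' \<in> arcs n" "a \<noteq> a'"
    and "\<And>xs. xs \<in> mids n p \<Longrightarrow> val xs = bnd \<Longrightarrow>
      a \<notin> path_arcs (stpath n xs) \<and> a' \<notin> path_arcs (stpath n xs)"
  shows "\<not> facet"
  by (rule not_facet_definingI_two_arcs[OF val_le assms])

lemma not_facet_no_tight:
  assumes "\<And>xs. xs \<in> mids n p \<Longrightarrow> val xs \<noteq> bnd"
  shows "\<not> facet"
  by (rule not_facet_two_arcs[of "(0, 1)" "(0, 2)"]) (use assms n5 in \<open>auto simp: arcs_iff\<close>)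

text \<open>Arcs from \<open>S\<close> to outside \<open>T\<close> vanish on the face; two
  \<open>S\<close>-nodes, or one \<open>S\<close>-node and two \<open>R\<close>-nodes, already
  provide two of them.\<close>

lemma not_facet_S_arcs:
  assumes "\<And>xs i j. xs \<in> mids n p \<Longrightarrow> val xs = bnd \<Longrightarrow> (i, j) \<in> path_arcs (stpath n xs) \<Longrightarrow> i \<in> S \<Longrightarrow> j \<in> T"
    and "2 \<le> card S \<or> S \<noteq> {} \<and> 2 \<le> card R"
  shows "\<not> facet"
  using assms(2)
proof
  assume "2 \<le> card S"
  then obtain s s' where s: "s \<in> S" "s' \<in> S" "s \<noteq> s'" using ex_two_elements by blast
  show ?thesis
    by (rule not_facet_two_arcs[of "(s, s')" "(s', s)"])
      (use s in_class(2)[of s] in_class(2)[of s'] assms(1)[of _ s s'] assms(1)[of _ s' s] in \<open>auto simp: arcs_iff\<close>)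
next
  assume "S \<noteq> {} \<and> 2 \<le> card R"
  then obtain s r r' where s: "s \<in> S" "r \<in> R" "r' \<in> R" "r \<noteq> r'" using ex_two_elements by blast
  show ?thesis
    by (rule not_facet_two_arcs[of "(s, r)" "(s, r')"])
      (use s in_class(2)[of s] in_class(1)[of r] in_class(1)[of r'] assms(1)[of _ s r] assms(1)[of _ s r']
        in \<open>auto simp: arcs_iff\<close>)
qed

text \<open>The mirror case: one inner \<open>T\<close>-node already gives two vanishing arcs,
  because \<open>0\<close> and \<open>n\<close> lie in \<open>T\<close> themselves.\<close>

lemma not_facet_T_arcs:
  assumes "\<And>xs i j. xs \<in> mids n p \<Longrightarrow> val xs = bnd \<Longrightarrow> (i, j) \<in> path_arcs (stpath n xs) \<Longrightarrow> j \<in> T \<Longrightarrow> i \<in> S"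
    and "T' \<noteq> {} \<or> 2 \<le> card R"
  shows "\<not> facet"
  using assms(2)
proof
  assume "T' \<noteq> {}"
  then obtain t where t: "t \<in> T'" by blast
  show ?thesis
    by (rule not_facet_two_arcs[of "(0, t)" "(t, n)"])
      (use t in_class(3)[of t] endpoints endpoints_class assms(1)[of _ 0 t] assms(1)[of _ t n]
        in \<open>auto simp: arcs_iff\<close>)
next
  assume "2 \<le> card R"
  then obtain r r' where r: "r \<in> R" "r' \<in> R" "r \<noteq> r'" using ex_two_elements by blast
  show ?thesis
    by (rule not_facet_two_arcs[of "(r, n)" "(r', n)"])
      (use r in_class(1)[of r] in_class(1)[of r'] endpoints assms(1)[of _ r n] assms(1)[of _ r' n]
        in \<open>auto simp: arcs_iff\<close>)
qed

text \<open>For even \<open>p + |R|\<close> a tight path has no defect at all, so every defective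
  arc vanishes on the face.\<close>

lemma even_not_facet:
  assumes "even (p + card R)"
  shows "\<not> facet"
proof -
  have z: "i \<in> S \<longleftrightarrow> j \<in> T"
    if "xs \<in> mids n p" "val xs = bnd" "(i, j) \<in> path_arcs (stpath n xs)" for xs i j
  proof (rule tight_counts[OF that(1,2)])
    fix \<alpha> \<beta> \<gamma> k :: nat
    assume "\<alpha> + \<beta> + \<gamma> = (p + card R) mod 2"
      "\<forall>i j. (i, j) \<in> path_arcs (stpath n xs) \<longrightarrow> i \<in> S \<longrightarrow> j \<notin> T \<longrightarrow> 1 \<le> \<beta>"
      "\<forall>i j. (i, j) \<in> path_arcs (stpath n xs) \<longrightarrow> i \<notin> S \<longrightarrow> j \<in> T \<longrightarrow> 1 \<le> \<gamma>"
    then show ?thesis using assms that(3) by (auto simp: even_iff_mod_2_eq_zero)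
  qed
  \<comment> \<open>Otherwise there would be at most two inner nodes, while
    \<open>n \<ge> 5\<close>.\<close>
  consider "2 \<le> card S" | "T' \<noteq> {} \<or> 2 \<le> card R"
    using card_nodes n5 by (cases "T' = {}") force+
  then show ?thesis
  proof cases
    case 1
    then show ?thesis using not_facet_S_arcs z by blast
  next
    case 2
    then show ?thesis using not_facet_T_arcs z by blast
  qed
qed

text \<open>Counting forces \<open>k = 1\<close> and \<beta> = 1, so arcs into \<open>T\<close> from
  outside \<open>S\<close> vanish; but the only such arc is \<open>(r, n)\<close>. The second
  equation is therefore that every tight path visits \<open>r\<close>.\<close>

lemma not_facet_p4_R1_T2:
  assumes p: "p = 4" and R: "R = {r}" and T': "T' = {}"
  shows "\<not> facet"
proof -
  define c1 :: vec where "c1 = (\<lambda>a. if a = (r, n) then 1 else 0)"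
  \<comment> \<open>Outflow of \<open>0\<close> minus outflow of \<open>r\<close>: it is 1 on paths
    that miss \<open>r\<close> and 0 on the others.\<close>
  define c2 :: vec where "c2 = (\<lambda>(i, j). of_bool (i = 0) - of_bool (i = r))"
  have r: "0 < r" "r < n" "r \<notin> S" "r \<notin> T" using in_class(1)[of r] R by auto
  have c1: "wsum c1 (stpath n xs) = of_bool ((r, n) \<in> path_arcs (stpath n xs))" if "xs \<in> mids n p" for xs
    using in_path_arcs_iff_wsum[OF distinct_stpath[OF that]] by (simp add: c1_def)
  have c2: "wsum c2 (stpath n xs) = 1 - of_bool (r \<in> set xs)" if "xs \<in> mids n p" for xs
  proof -
    have d: "distinct xs" "0 \<notin> set xs" using that by (auto simp: mids_def)
    have "(\<Sum>v\<in>set xs. of_bool (v = 0) - of_bool (v = r) :: real) = - of_bool (r \<in> set xs)"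
    proof -
      have "(\<Sum>v\<in>set xs. of_bool (v = 0) - of_bool (v = r) :: real) = (\<Sum>v\<in>set xs. if v = r then - 1 else 0)"
      proof (intro sum.cong refl)
        fix v assume "v \<in> set xs"
        then have "v \<noteq> 0" using d(2) by metis
        then show "of_bool (v = 0) - of_bool (v = r) = (if v = r then - 1 else 0 :: real)" by simp
      qed
      then show ?thesis by (simp add: of_bool_def)
    qed
    then show ?thesis using d r by (simp add: c2_def wsum_out)
  qed
  have tight: "(r, n) \<notin> path_arcs (stpath n xs) \<and> r \<in> set xs" if "xs \<in> mids n p" "val xs = bnd" for xs
  proof (rule tight_counts[OF that])
    fix \<alpha> \<beta> \<gamma> k :: nat
    assume *: "\<alpha> + \<beta> + \<gamma> = (p + card R) mod 2" "card (R - set xs) = \<alpha>" "card (T' \<inter> set xs) + 1 = k + \<gamma>"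
      "p + \<alpha> = card R + 2 * k + \<beta> + \<gamma>"
      "\<forall>i j. (i, j) \<in> path_arcs (stpath n xs) \<longrightarrow> i \<notin> S \<longrightarrow> j \<in> T \<longrightarrow> 1 \<le> \<gamma>"
    have "\<alpha> + \<beta> + \<gamma> = 1" using *(1) by (simp add: p R)
    moreover have "3 + \<alpha> = 2 * k + \<beta> + \<gamma>" "k + \<gamma> = 1" using *(3,4) by (simp_all add: p R T')
    ultimately have "\<alpha> = 0" "\<gamma> = 0" by linarith+
    then show ?thesis using *(2,5) r endpoints R by (auto simp: card_eq_0_iff)
  qed
  obtain y1 where y1: "y1 \<in> mids n p" "(r, n) \<in> path_arcs (stpath n y1)"
    using ex_path_arc[of "(r, n)"] r by (auto simp: arcs_iff)
  have "r \<in> set y1" using y1(2) path_arcs_butlast_tl[of "stpath n y1"] r by (auto simp: butlast_append)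
  obtain y2 where y2: "distinct y2" "set y2 \<subseteq> {0<..<n} - {r}" "length y2 = 3"
  proof -
    have "3 \<le> card ({0<..<n} - {r})" using r n5 by simp
    then show ?thesis using ex_distinct_list[of "{0<..<n} - {r}" 3] that by blast
  qed
  then have y2': "y2 \<in> mids n p" "r \<notin> set y2" by (auto simp: mids_def p)
  show ?thesis
    by (rule not_facet_definingI[OF val_le, of c1 c2 y1 y2]) (use tight c1 c2 y1 y2' \<open>r \<in> set y1\<close> in simp_all)
qed

text \<open>The second equation is \<open>x\<^sub>t\<^sub>r = x\<^sub>0\<^sub>t + x\<^sub>r\<^sub>n\<close>, which every tight path satisfies.\<close>

lemma not_facet_p4_R1_T3:
  assumes p: "p = 4" and R: "R = {r}" and T': "T' = {t}"
  shows "\<not> facet"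
proof -
  have r: "0 < r" "r < n" "r \<notin> S" "r \<notin> T" and t: "0 < t" "t < n" "t \<notin> S" "t \<in> T" "t \<noteq> r"
    using in_class(1)[of r] in_class(3)[of t] R T' by auto
  have "card S \<noteq> 0" using card_nodes n5 R T' by auto
  then obtain s where "s \<in> S" by fastforce
  then have s: "s \<in> S" "0 < s" "s < n" "s \<notin> T" "s \<noteq> r" "s \<noteq> t" using in_class(2)[of s] r t by auto
  have b: "bnd = 2" by (simp add: p R)
  have f: "fcoef (i, j) = of_bool (i = r \<or> i \<in> S \<and> j \<in> T)" for i j
    unfolding fcoef_def using R by simp
  \<comment> \<open>The tightness equation itself, with \<open>bnd = 2\<close> attached to the arcs
    leaving \<open>0\<close>, is the first of the two equations.\<close>
  define c1 :: vec where "c1 = (\<lambda>a. 1 * fcoef a + (- 2) * (if fst a = 0 then 1 else 0))"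
  define c2 :: vec where "c2 = (\<lambda>a. of_bool (a = (t, r)) - of_bool (a = (0, t)) - of_bool (a = (r, n)))"
  have T: "v \<in> T \<longleftrightarrow> v = t" if "0 < v" "v < n" for v using that T' by (auto simp: T'_def)
  have V: "v = r \<or> v = t \<or> v \<in> S" if "0 < v" "v < n" for v
  proof -
    have "v \<in> R \<union> S \<union> T'" using that unfolding nodes(4) by simp
    then show ?thesis by (auto simp: R T')
  qed
  have c: "wsum c1 (stpath n xs) = 0 \<and> wsum c2 (stpath n xs) = 0" if xs: "xs \<in> mids n p" "val xs = bnd" for xs
  proof -
    have "length xs = 3" using xs by (simp add: mids_def p)
    then obtain x y z where e: "xs = [x, y, z]" by (auto simp: length_Suc_conv numeral_3_eq_3)
    have d: "x \<noteq> y" "x \<noteq> z" "y \<noteq> z" "0 < x" "x < n" "0 < y" "y < n" "0 < z" "z < n"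
      using xs(1) by (auto simp: mids_def e)
    have val: "of_bool (x = r \<or> x \<in> S \<and> y = t) + of_bool (y = r \<or> y \<in> S \<and> z = t) + of_bool (z = r \<or> z \<in> S) = (2::real)"
      using xs(2) d T[of x] T[of y] T[of z] endpoints endpoints_class r unfolding b
      by (simp add: e f)
    have "of_bool (x = t \<and> y = r) + of_bool (y = t \<and> z = r) - of_bool (x = t) - of_bool (z = r) = (0::real)"
      using val V[of x] V[of y] V[of z] d r t by auto
    then have "wsum c2 (stpath n xs) = 0" using d r t by (auto simp: e c2_def)
    moreover have "wsum c1 (stpath n xs) = 0" using xs(2) d unfolding b by (simp add: e c1_def)
    ultimately show ?thesis by blast
  qed
  \<comment> \<open>\<open>[s, r, t]\<close> has value 1 yet satisfies the second equation;
    \<open>[t, s, r]\<close> violates the latter, as it uses \<open>(0, t)\<close> and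
    \<open>(r, n)\<close> but not \<open>(t, r)\<close>.\<close>
  show ?thesis
  proof (rule not_facet_definingI[OF val_le, of c1 c2 "[s, r, t]" "[t, s, r]"])
    show "[s, r, t] \<in> mids n p" "[t, s, r] \<in> mids n p" using r t s by (auto simp: mids_def p)
    show "wsum c1 (stpath n [s, r, t]) \<noteq> 0"
      using r t s endpoints_class by (simp add: c1_def f)
    show "wsum c2 (stpath n [s, r, t]) = 0" "wsum c2 (stpath n [t, s, r]) \<noteq> 0"
      using r t s by (auto simp: c2_def)
  qed (use c in auto)
qed

lemma facet_imp:
  assumes "facet"
  shows "odd (p + card R)" "2 * card S > p - card R" "2 * (card T' + 1) > p - card R"
    "p = card R + 3 \<and> 2 \<le> card R \<and> card T' = 1 \<or> p \<ge> card R + 5"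
proof -
  show odd: "odd (p + card R)" using assms even_not_facet by blast
  then have m: "(p + card R) mod 2 = 1" by presburger
  \<comment> \<open>The arc into \<open>n\<close> contributes to \<open>k\<close> or \<gamma>, so
    \<open>k + \<gamma> \<ge> 1\<close>; with a single defect and \<open>p \<le> |R|\<close> the
    node count has no solution.\<close>
  have p1: "card R + 1 \<le> p"
  proof (rule ccontr)
    assume n: "\<not> card R + 1 \<le> p"
    have "val xs \<noteq> bnd" if "xs \<in> mids n p" for xs
    proof
      assume "val xs = bnd"
      from tight_counts[OF that this] obtain \<alpha> \<beta> \<gamma> k where
        "\<alpha> + \<beta> + \<gamma> = 1" "card (T' \<inter> set xs) + 1 = k + \<gamma>" "p + \<alpha> = card R + 2 * k + \<beta> + \<gamma>"
        using m by metis
      then show False using n by linarith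
    qed
    then show False using assms not_facet_no_tight by blast
  qed
  have "p \<noteq> card R + 1"
  proof
    assume p: "p = card R + 1"
    \<comment> \<open>Either \<alpha> = 1 and \<open>k = 1\<close>, or \<gamma> = 1 and
      \<open>k = 0\<close>. In both cases \<open>k + \<gamma> = 1\<close>, so no inner
      \<open>T\<close>-node is visited.\<close>
    have *: "(i \<in> S \<longrightarrow> j \<in> T) \<and> i \<notin> T' \<and> j \<notin> T'"
      if "xs \<in> mids n p" "val xs = bnd" "(i, j) \<in> path_arcs (stpath n xs)" for xs i j
    proof (rule tight_counts[OF that(1,2)])
      fix \<alpha> \<beta> \<gamma> k :: nat
      assume *: "\<alpha> + \<beta> + \<gamma> = (p + card R) mod 2" "card (T' \<inter> set xs) + 1 = k + \<gamma>" "p + \<alpha> = card R + 2 * k + \<beta> + \<gamma>"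
        "\<forall>i j. (i, j) \<in> path_arcs (stpath n xs) \<longrightarrow> i \<in> S \<longrightarrow> j \<notin> T \<longrightarrow> 1 \<le> \<beta>"
      have 1: "\<alpha> + \<beta> + \<gamma> = 1" "1 + \<alpha> = 2 * k + \<beta> + \<gamma>" using *(1,3) m p by simp_all
      then have "\<beta> = 0" "card (T' \<inter> set xs) = 0" using *(2) by linarith+
      moreover have "T' \<inter> set (stpath n xs) = T' \<inter> set xs" using nodes(3) by auto
      moreover have "i \<in> set (stpath n xs)" "j \<in> set (stpath n xs)" using path_arcs_subset that(3) by blast+
      ultimately show ?thesis using *(4) that(3) finite_RST(4) by (auto simp: card_eq_0_iff)
    qed
    show False
    proof (cases "T' = {}")
      case False
      then obtain t where t: "t \<in> T'" by blast
      have "\<not> facet"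
        by (rule not_facet_two_arcs[of "(0, t)" "(t, n)"])
          (use t in_class(3)[of t] *[of _ 0 t] *[of _ t n] in \<open>auto simp: arcs_iff\<close>)
      then show False using assms by blast
    next
      case True
      then have "S \<noteq> {}" "2 \<le> card R" using card_nodes p p4 pn by auto
      then show False using not_facet_S_arcs * assms by blast
    qed
  qed
  moreover have "p \<noteq> card R + 2" "p \<noteq> card R + 4" using odd by auto
  ultimately have p35: "p = card R + 3 \<or> card R + 5 \<le> p" using p1 by linarith
  have c: "2 \<le> card R \<and> card T' = 1" if p: "p = card R + 3"
  proof (rule ccontr)
    assume n: "\<not> (2 \<le> card R \<and> card T' = 1)"
    have R1: "1 \<le> card R" using p p4 by simp
    \<comment> \<open>The count leaves \<alpha> = 1 with \<open>k = 2\<close>, \<beta> = 1 with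
      \<open>k = 1\<close>, or \<gamma> = 1 with \<open>k = 1\<close>; these visit 1, 0 and 1 inner
      \<open>T\<close>-nodes.\<close>
    have cnt: "card (T' \<inter> set xs) \<le> 1 \<and> (T' = {} \<longrightarrow> (\<forall>i j. (i, j) \<in> path_arcs (stpath n xs) \<longrightarrow> j \<in> T \<longrightarrow> i \<in> S))"
      if "xs \<in> mids n p" "val xs = bnd" for xs
    proof (rule tight_counts[OF that(1,2)])
      fix \<alpha> \<beta> \<gamma> k :: nat
      assume *: "\<alpha> + \<beta> + \<gamma> = (p + card R) mod 2" "card (T' \<inter> set xs) + 1 = k + \<gamma>" "p + \<alpha> = card R + 2 * k + \<beta> + \<gamma>"
        "\<forall>i j. (i, j) \<in> path_arcs (stpath n xs) \<longrightarrow> i \<notin> S \<longrightarrow> j \<in> T \<longrightarrow> 1 \<le> \<gamma>"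
      have 1: "\<alpha> + \<beta> + \<gamma> = 1" "3 + \<alpha> = 2 * k + \<beta> + \<gamma>" using *(1,3) m p by simp_all
      then have "card (T' \<inter> set xs) \<le> 1" using *(2) by linarith
      moreover have "\<gamma> = 0" if "T' = {}" using that 1 *(2) by simp
      ultimately show ?thesis using *(4) by fastforce
    qed
    consider "2 \<le> card T'" | "T' = {}" "2 \<le> card R" | "T' = {}" "card R = 1" | "card T' = 1" "card R = 1"
    proof -
      have "card T' = 0 \<longleftrightarrow> T' = {}" using finite_RST by simp
      then show ?thesis using that n R1 by linarith
    qed
    then have "\<not> facet"
    proof cases
      case 1
      then obtain t t' where t: "t \<in> T'" "t' \<in> T'" "t \<noteq> t'" using ex_two_elements by blast
      have "\<not> {t, t'} \<subseteq> set (stpath n xs)" if "xs \<in> mids n p" "val xs = bnd" for xs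
      proof
        assume "{t, t'} \<subseteq> set (stpath n xs)"
        then have "{t, t'} \<subseteq> T' \<inter> set xs" using t in_class(3)[of t] in_class(3)[of t'] by auto
        then have "card {t, t'} \<le> card (T' \<inter> set xs)" by (intro card_mono) auto
        then show False using cnt[OF that] t by simp
      qed
      then have "(t, t') \<notin> path_arcs (stpath n xs) \<and> (t', t) \<notin> path_arcs (stpath n xs)"
        if "xs \<in> mids n p" "val xs = bnd" for xs
        using that path_arcs_subset[of "stpath n xs"] by blast
      then show ?thesis
        by (intro not_facet_two_arcs[of "(t, t')" "(t', t)"])
          (use t in_class(3)[of t] in_class(3)[of t'] in \<open>auto simp: arcs_iff\<close>)
    next
      case 2
      then show ?thesis using not_facet_T_arcs cnt by blast
    next
      case 3
      then show ?thesis using not_facet_p4_R1_T2 p by (auto simp: card_1_singleton_iff)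
    next
      case 4
      then show ?thesis using not_facet_p4_R1_T3 p by (auto simp: card_1_singleton_iff)
    qed
    then show False using assms by blast
  qed
  show "p = card R + 3 \<and> 2 \<le> card R \<and> card T' = 1 \<or> p \<ge> card R + 5" using p35 c by blast
  have p3: "card R + 3 \<le> p" using p35 by linarith
  show "2 * card S > p - card R"
  proof (rule ccontr)
    assume n: "\<not> 2 * card S > p - card R"
    \<comment> \<open>From \<open>k + \<beta> \<le> |S|\<close> and the assumed bound on
      \<open>|S|\<close> the node count yields \<alpha> + \<beta> \<le> \<gamma>, so the single
      defect is an arc into \<open>T\<close>.\<close>
    have cnt: "(\<forall>i j. (i, j) \<in> path_arcs (stpath n xs) \<longrightarrow> i \<in> S \<longrightarrow> j \<in> T) \<and> p = card R + 2 * card (S \<inter> set xs) + 1"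
      if "xs \<in> mids n p" "val xs = bnd" for xs
    proof (rule tight_counts[OF that(1,2)])
      fix \<alpha> \<beta> \<gamma> k :: nat
      assume *: "\<alpha> + \<beta> + \<gamma> = (p + card R) mod 2" "card (S \<inter> set xs) = k + \<beta>" "p + \<alpha> = card R + 2 * k + \<beta> + \<gamma>"
        "\<forall>i j. (i, j) \<in> path_arcs (stpath n xs) \<longrightarrow> i \<in> S \<longrightarrow> j \<notin> T \<longrightarrow> 1 \<le> \<beta>"
      have "card (S \<inter> set xs) \<le> card S" using finite_RST by (intro card_mono) auto
      then have "\<beta> = 0 \<and> \<alpha> = 0" using * n m p3 by linarith
      then show ?thesis using * m by auto
    qed
    consider "2 \<le> card S \<or> S \<noteq> {} \<and> 2 \<le> card R" | "card S = 0 \<or> card S = 1 \<and> card R + 5 \<le> p"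
    proof -
      have "card S = 0 \<longleftrightarrow> S = {}" using finite_RST by simp
      then show ?thesis using that p35 c by linarith
    qed
    then have "\<not> facet"
    proof cases
      case 1
      then show ?thesis using not_facet_S_arcs cnt by blast
    next
      case 2
      have "val xs \<noteq> bnd" if "xs \<in> mids n p" for xs
      proof
        assume "val xs = bnd"
        then have "p = card R + 2 * card (S \<inter> set xs) + 1" using cnt that by blast
        moreover have "card (S \<inter> set xs) \<le> card S" using finite_RST by (intro card_mono) auto
        ultimately show False using 2 p3 by linarith
      qed
      then show ?thesis using not_facet_no_tight by blast
    qed
    then show False using assms by blast
  qed
  show "2 * (card T' + 1) > p - card R"
  proof (rule ccontr)
    assume n: "\<not> 2 * (card T' + 1) > p - card R"
    \<comment> \<open>Likewise \<open>k + \<gamma> \<le> |T'| + 1\<close> yields \<alpha> + \<gamma>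
      \<le> \<beta>, so the single defect is an arc leaving \<open>S\<close>.\<close>
    have cnt: "(\<forall>i j. (i, j) \<in> path_arcs (stpath n xs) \<longrightarrow> j \<in> T \<longrightarrow> i \<in> S) \<and> p = card R + 2 * card (T' \<inter> set xs) + 3"
      if "xs \<in> mids n p" "val xs = bnd" for xs
    proof (rule tight_counts[OF that(1,2)])
      fix \<alpha> \<beta> \<gamma> k :: nat
      assume *: "\<alpha> + \<beta> + \<gamma> = (p + card R) mod 2" "card (T' \<inter> set xs) + 1 = k + \<gamma>" "p + \<alpha> = card R + 2 * k + \<beta> + \<gamma>"
        "\<forall>i j. (i, j) \<in> path_arcs (stpath n xs) \<longrightarrow> i \<notin> S \<longrightarrow> j \<in> T \<longrightarrow> 1 \<le> \<gamma>"
      have "card (T' \<inter> set xs) \<le> card T'" using finite_RST by (intro card_mono) auto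
      moreover have "2 * card T' + 2 + card R \<le> p" using n p3 by simp
      ultimately have "\<gamma> = 0 \<and> \<alpha> = 0" using * m by linarith
      then show ?thesis using * m by auto
    qed
    consider "T' \<noteq> {}" | "T' = {}" "card R + 5 \<le> p" using p35 c by fastforce
    then have "\<not> facet"
    proof cases
      case 1
      then show ?thesis using not_facet_T_arcs cnt by blast
    next
      case 2
      have "val xs \<noteq> bnd" if "xs \<in> mids n p" for xs using cnt[OF that] 2 by auto
      then show ?thesis using not_facet_no_tight by blast
    qed
    then show False using assms by blast
  qed
qed

end

section \<open>Sufficiency\<close>

lemma wsum_append:
  "xs \<noteq> [] \<Longrightarrow> ys \<noteq> [] \<Longrightarrow> wsum c (xs @ ys) = wsum c xs + c (last xs, hd ys) + wsum c ys"
proof (induction xs)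
  case (Cons x xs)
  then show ?case by (cases xs; cases ys) auto
qed simp

text \<open>The facet conditions in integers: \<open>p - |R|\<close> is odd, hence
  \<open>2 * m + 1\<close>, which turns the strict bounds into those on \<open>|S|\<close> and
  \<open>|T'|\<close>; \<open>m = 1\<close> is the case \<open>p = |R| + 3\<close>.\<close>

locale gmc_facet = gmc +
  fixes m :: nat
  assumes p_eq: "p = card R + 2 * m + 1" and cardS: "m + 1 \<le> card S" and cardT: "m \<le> card T'"
    and cases_m: "m = 1 \<and> 2 \<le> card R \<and> card T' = 1 \<or> 2 \<le> m"
begin

lemma disjoint: "R \<inter> S = {}" "R \<inter> T' = {}" "S \<inter> T' = {}"
  using part by (auto simp: T'_def)

lemma m1: "1 \<le> m" using cases_m by auto

lemma tightI:
  assumes "distinct xs" "set xs \<subseteq> {0<..<n}" "length xs = p - 1"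
    "wsum sig (stpath n xs) + real (card (R - set xs)) = 1"
  shows "xs \<in> mids n p \<and> val xs = bnd"
proof -
  have xs: "xs \<in> mids n p" using assms(1-3) by (simp add: mids_def)
  have "(p + card R) mod 2 = 1" unfolding p_eq by presburger
  then show ?thesis using tight_iff[OF xs] xs assms(4) by simp
qed

text \<open>A filler takes up the part of a path that is kept fixed in an exchange argument: it visits the
  nodes of \<open>R\<close> outside \<open>X\<close> and \<open>m - 1\<close> pairs from \<open>S \<times> T\<close>, and it can be inserted after every
  node outside \<open>S\<close> without changing the slack.\<close>

definition filler :: "nat set \<Rightarrow> nat list \<Rightarrow> bool" where
  "filler X W \<longleftrightarrow> distinct W \<and> set W \<subseteq> {0<..<n} - X \<and> R - X \<subseteq> set W \<and>
     length W = card (R - X) + 2 * (m - 1) \<and> wsum sig W = 0 \<and> W \<noteq> [] \<and> hd W \<notin> T \<and> last W \<notin> S"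

text \<open>Of the \<open>p - 1 = |R| + 2 * m\<close> inner nodes the filler leaves
  \<open>|Y| + 2\<close> to be placed around it. Since \<open>W\<close> starts outside
  \<open>T\<close> and ends outside \<open>S\<close>, the two joints add a defect only if the node
  after \<open>W\<close> lies in \<open>T\<close>.\<close>

lemma tight_insert_filler:
  assumes W: "filler X W" and Y: "R \<inter> X = Y"
    and Q: "distinct (Q1 @ Q2)" "set (Q1 @ Q2) \<subseteq> X \<inter> {0<..<n}" "length (Q1 @ Q2) = card Y + 2"
    and l: "last (0 # Q1) \<notin> S"
    and slack: "wsum sig (0 # Q1) + of_bool (hd (Q2 @ [n]) \<in> T) + wsum sig (Q2 @ [n])
      + real (card (Y - set (Q1 @ Q2))) = 1"
  shows "Q1 @ W @ Q2 \<in> mids n p \<and> val (Q1 @ W @ Q2) = bnd"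
    "wsum c (stpath n (Q1 @ W @ Q2)) = wsum c (0 # Q1) + c (last (0 # Q1), hd W) + wsum c W
      + c (last W, hd (Q2 @ [n])) + wsum c (Q2 @ [n])"
proof -
  note W' = W[unfolded filler_def]
  have dec: "wsum c (stpath n (Q1 @ W @ Q2)) = wsum c (0 # Q1) + c (last (0 # Q1), hd W) + wsum c W
      + c (last W, hd (Q2 @ [n])) + wsum c (Q2 @ [n])" for c
    using wsum_append[of "0 # Q1" "W @ Q2 @ [n]" c] wsum_append[of W "Q2 @ [n]" c] W' by simp
  then show "wsum c (stpath n (Q1 @ W @ Q2)) = wsum c (0 # Q1) + c (last (0 # Q1), hd W) + wsum c W
      + c (last W, hd (Q2 @ [n])) + wsum c (Q2 @ [n])" .
  show "Q1 @ W @ Q2 \<in> mids n p \<and> val (Q1 @ W @ Q2) = bnd"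
  proof (rule tightI)
    show "distinct (Q1 @ W @ Q2)" "set (Q1 @ W @ Q2) \<subseteq> {0<..<n}" using W' Q by auto
    have "card (R - X) + card Y = card R"
      using finite_RST Y by (metis add.commute card_Int_Diff)
    then show "length (Q1 @ W @ Q2) = p - 1" using W' Q(3) p_eq m1 by simp
    have "R - set (Q1 @ W @ Q2) = Y - set (Q1 @ Q2)" using W' Y by auto
    moreover have "sig (last (0 # Q1), hd W) = 0" using l W' by (simp add: sig_def)
    moreover have "sig (last W, hd (Q2 @ [n])) = of_bool (hd (Q2 @ [n]) \<in> T)"
      using W' by (simp add: sig_def)
    ultimately show "wsum sig (stpath n (Q1 @ W @ Q2)) + real (card (R - set (Q1 @ W @ Q2))) = 1"
      using dec[of sig] slack W' by simp
  qed
qed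

lemma wsum_sig_R: "set rs \<subseteq> R \<Longrightarrow> wsum sig rs = 0"
proof (induction sig rs rule: wsum.induct)
  case (1 x y zs)
  then show ?case using in_class(1)[of x] in_class(1)[of y] by (auto simp: sig_def)
qed auto

text \<open>Nodes of \<open>S\<close> and \<open>T'\<close> alternate: neither an arc from
  \<open>S\<close> to \<open>T\<close> nor one from \<open>T\<close> back to \<open>S\<close> is a
  defect.\<close>

lemma ex_blocks:
  assumes "A \<subseteq> S" "B \<subseteq> T'" "k \<le> card A" "k \<le> card B"
  shows "\<exists>Z. distinct Z \<and> set Z \<subseteq> A \<union> B \<and> length Z = 2 * k \<and> wsum sig Z = 0 \<and>
    (Z \<noteq> [] \<longrightarrow> hd Z \<in> S \<and> last Z \<in> T')"
  using assms
proof (induction k arbitrary: A B)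
  case 0
  show ?case by (rule exI[of _ "[]"]) simp
next
  case (Suc k)
  have fin: "finite A" "finite B"
    using finite_subset[OF Suc.prems(1) finite_RST(2)] finite_subset[OF Suc.prems(2) finite_RST(4)] .
  obtain s t where st: "s \<in> A" "t \<in> B" using Suc.prems(3,4) by (cases "A = {}"; cases "B = {}") auto
  then have c: "k \<le> card (A - {s})" "k \<le> card (B - {t})" using Suc.prems fin by simp_all
  obtain Z where Z: "distinct Z" "set Z \<subseteq> (A - {s}) \<union> (B - {t})" "length Z = 2 * k" "wsum sig Z = 0"
    "Z \<noteq> [] \<longrightarrow> hd Z \<in> S \<and> last Z \<in> T'"
  proof -
    have "A - {s} \<subseteq> S" "B - {t} \<subseteq> T'" using Suc.prems by auto
    from Suc.IH[OF this c] show ?thesis using that by blast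
  qed
  have cl: "s \<in> S" "t \<in> T'" "s \<notin> T" "t \<notin> S" "t \<in> T"
    using st Suc.prems(1,2) in_class(2)[of s] in_class(3)[of t] by auto
  have "A \<inter> B = {}" using Suc.prems(1,2) in_class(3) by blast
  then have "distinct (s # t # Z)" using Z st by auto
  moreover have "wsum sig (s # t # Z) = 0"
  proof (cases Z)
    case (Cons z Z')
    then show ?thesis using Z(4,5) cl in_class(2)[of z] by (simp add: sig_def)
  qed (use cl in \<open>simp add: sig_def\<close>)
  ultimately show ?case using Z st cl by (intro exI[of _ "s # t # Z"]) auto
qed

lemma ex_R_list:
  assumes "z \<in> R - X"
  shows "\<exists>rs. distinct (rs @ [z]) \<and> set (rs @ [z]) = R - X"
proof -
  obtain rs where "set rs = R - X - {z}" "distinct rs"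
    using finite_distinct_list[of "R - X - {z}"] finite_RST by blast
  then show ?thesis using assms by (intro exI[of _ rs]) auto
qed

lemma ex_filler_R:
  assumes "m - 1 \<le> card (S - X)" "m - 1 \<le> card (T' - X)" "z \<in> R - X"
  shows "\<exists>W. filler X W \<and> last W = z"
proof -
  obtain rs where rs: "distinct (rs @ [z])" "set (rs @ [z]) = R - X" using ex_R_list[OF assms(3)] by blast
  obtain Z where Z: "distinct Z" "set Z \<subseteq> (S - X) \<union> (T' - X)" "length Z = 2 * (m - 1)" "wsum sig Z = 0"
    "Z \<noteq> [] \<longrightarrow> hd Z \<in> S \<and> last Z \<in> T'"
    using ex_blocks[of "S - X" "T' - X" "m - 1"] assms by blast
  define W where "W = Z @ rs @ [z]"
  have R: "wsum sig (rs @ [z]) = 0" using rs(2) by (intro wsum_sig_R) auto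
  have hR: "hd (rs @ [z]) \<in> R" using rs(2) hd_in_set[of "rs @ [z]"] by blast
  have "set (rs @ [z]) \<inter> set Z = {}" using Z(2) disjoint unfolding rs(2) by blast
  then have "distinct W" using rs(1) Z(1) by (auto simp: W_def)
  moreover have "set W \<subseteq> {0<..<n} - X" using rs(2) Z(2) nodes(1-3) by (auto simp: W_def)
  moreover have "length W = card (R - X) + 2 * (m - 1)"
    using Z(3) distinct_card[OF rs(1)] rs(2) by (simp add: W_def)
  moreover have "wsum sig W = 0"
  proof (cases "Z = []")
    case False
    then have "wsum sig W = sig (last Z, hd (rs @ [z]))"
      using wsum_append[of Z "rs @ [z]" sig] R Z(4) by (simp add: W_def)
    then show ?thesis using False Z(5) in_class(3)[of "last Z"] in_class(1)[OF hR] by (simp add: sig_def)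
  qed (use R in \<open>simp add: W_def\<close>)
  moreover have "hd W \<notin> T"
    using Z(5) hR in_class(1)[of "hd (rs @ [z])"] in_class(2)[of "hd Z"] by (cases "Z = []") (auto simp: W_def)
  moreover have "last W \<notin> S" using in_class(1) assms(3) by (simp add: W_def)
  moreover have "R - X \<subseteq> set W" using rs(2) by (auto simp: W_def)
  ultimately have "filler X W" by (simp add: filler_def W_def)
  then show ?thesis by (auto simp: W_def)
qed

text \<open>\<open>R\<close>-nodes come first and the prescribed node completes the last of the
  \<open>m - 1\<close> pairs, which leaves \<open>m - 2\<close> blocks to choose. Reserving
  \<open>z\<close> and \<open>z'\<close> gives two fillers that differ in the last node
  only.\<close>

lemma ex_filler_T:
  assumes "2 \<le> m" "m - 1 \<le> card (S - X)" "m - 2 \<le> card (T' - X - {z, z'})" "z \<in> T' - X" "z' \<in> T' - X"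
  shows "\<exists>U. filler X (U @ [z]) \<and> filler X (U @ [z']) \<and> U \<noteq> [] \<and> last U \<in> S \<and> (r \<in> R - X \<longrightarrow> hd U = r)"
proof -
  obtain rs where rs: "distinct rs" "set rs = R - X" "r \<in> R - X \<longrightarrow> rs \<noteq> [] \<and> hd rs = r"
  proof (cases "r \<in> R - X")
    case True
    obtain rs where "distinct rs" "set rs = R - X - {r}"
      using finite_distinct_list[of "R - X - {r}"] finite_RST by blast
    then show ?thesis using that[of "r # rs"] True by auto
  next
    case False
    then show ?thesis using that finite_distinct_list[of "R - X"] finite_RST by blast
  qed
  obtain s where s: "s \<in> S - X" using assms(1,2) by (cases "S - X = {}") auto
  have "m - 2 \<le> card (S - X - {s})" using s assms(2) finite_RST by simp
  then obtain Z where Z: "distinct Z" "set Z \<subseteq> (S - X - {s}) \<union> (T' - X - {z, z'})" "length Z = 2 * (m - 2)"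
    "wsum sig Z = 0" "Z \<noteq> [] \<longrightarrow> hd Z \<in> S \<and> last Z \<in> T'"
    using ex_blocks[of "S - X - {s}" "T' - X - {z, z'}" "m - 2"] assms(3) by blast
  define U where "U = rs @ Z @ [s]"
  have sS: "s \<in> S" "s \<notin> T" "s \<notin> R" using s in_class(2)[of s] by auto
  have "filler X (U @ [y])" if y: "y \<in> {z, z'}" for y
  proof -
    have yT: "y \<in> T'" "y \<in> T" "y \<notin> S" "y \<notin> R" "y \<notin> X" using y assms(4,5) in_class(3)[of y] by auto
    have ZR: "v \<notin> R" if "v \<in> set Z" for v using that Z(2) in_class(2,3)[of v] by auto
    have "wsum sig (Z @ [s, y]) = 0"
    proof (cases "Z = []")
      case False
      then have "wsum sig (Z @ [s, y]) = sig (last Z, s) + sig (s, y)"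
        using wsum_append[of Z "[s, y]" sig] Z(4) by simp
      then show ?thesis using False Z(5) in_class(3)[of "last Z"] sS yT by (simp add: sig_def)
    qed (use sS yT in \<open>simp add: sig_def\<close>)
    moreover have hS: "hd (Z @ [s, y]) \<in> S" using Z(5) sS by (cases Z) auto
    ultimately have w: "wsum sig (U @ [y]) = 0"
    proof (cases "rs = []")
      case False
      then have "last rs \<in> R" using rs(2) last_in_set[of rs] by blast
      moreover have "wsum sig rs = 0" using rs(2) by (intro wsum_sig_R) auto
      ultimately show ?thesis
        using wsum_append[OF False, of "Z @ [s, y]" sig] \<open>wsum sig (Z @ [s, y]) = 0\<close> hS
          in_class(1)[of "last rs"] in_class(2)[OF hS] by (simp add: U_def sig_def)
    qed (simp add: U_def)
    have "hd (U @ [y]) \<notin> T"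
    proof (cases "rs = []")
      case False
      then have "hd rs \<in> R" using rs(2) hd_in_set[of rs] by blast
      then show ?thesis using False in_class(1)[of "hd rs"] by (simp add: U_def)
    qed (use hS in_class(2)[OF hS] in \<open>simp add: U_def\<close>)
    moreover have "s \<notin> set Z" "y \<notin> set Z" "s \<noteq> y" using Z(2) y yT sS disjoint by blast+
    then have "distinct (U @ [y])" using rs(1,2) Z(1) ZR sS yT by (auto simp: U_def)
    moreover have "set (U @ [y]) \<subseteq> {0<..<n} - X" using rs(2) Z(2) nodes(1-3) s yT by (auto simp: U_def)
    moreover have "length (U @ [y]) = card (R - X) + 2 * (m - 1)"
      using Z(3) distinct_card[OF rs(1)] rs(2) assms(1) by (simp add: U_def)
    moreover have "R - X \<subseteq> set (U @ [y])" using rs(2) by (auto simp: U_def)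
    ultimately show ?thesis using w yT by (simp add: filler_def)
  qed
  then show ?thesis using sS rs(3) by (intro exI[of _ U]) (auto simp: U_def)
qed

lemma ex_filler_R_first:
  assumes "m = 1" "r \<in> R - X" "z \<in> R - X" "r \<noteq> z"
  shows "\<exists>W. filler X W \<and> hd W = r"
proof -
  obtain rs where rs: "distinct (rs @ [z])" "set (rs @ [z]) = R - (insert r X)"
    using ex_R_list[of z "insert r X"] assms by blast
  have s: "set (r # rs @ [z]) = R - X" and d: "distinct (r # rs @ [z])" using rs assms by auto
  have "wsum sig (r # rs @ [z]) = 0" using s by (intro wsum_sig_R) auto
  moreover have "length (r # rs @ [z]) = card (R - X)" using distinct_card[OF d] s by simp
  moreover have "set (r # rs @ [z]) \<subseteq> {0<..<n} - X" using s nodes(1) by blast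
  ultimately have "filler X (r # rs @ [z])"
    unfolding filler_def using d s assms(1) in_class(1)[of r] in_class(1)[of z] assms by auto
  then show ?thesis by fastforce
qed

text \<open>The nodes that can be prescribed as the last node of a filler.\<close>

definition "Hub = R \<union> (if 2 \<le> m then T' else {})"

lemma Hub_class: "z \<in> Hub \<Longrightarrow> z \<in> R \<or> z \<in> T' \<and> 2 \<le> m" by (auto simp: Hub_def split: if_splits)

text \<open>The bounds 2 and 1 match \<open>m + 1 \<le> |S|\<close> and \<open>m \<le> |T'|\<close>:
  in both classes at least \<open>m - 1\<close> nodes remain for the pairs.\<close>

lemma ex_filler:
  assumes X: "finite X" "card (S \<inter> X) \<le> 2" "card (T' \<inter> X) \<le> 1" and z: "z \<in> Hub" "z \<notin> X"
  shows "\<exists>W. filler X W \<and> last W = z"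
proof -
  have "card (S - X) + card (S \<inter> X) = card S" "card (T' - X) + card (T' \<inter> X) = card T'"
    using finite_RST card_Int_Diff by (metis add.commute)+
  then have c: "m - 1 \<le> card (S - X)" "m - 1 \<le> card (T' - X)" using cardS cardT X by linarith+
  show ?thesis
  proof (cases "z \<in> R")
    case True
    then show ?thesis using ex_filler_R c z by blast
  next
    case False
    then have zT: "z \<in> T'" "2 \<le> m" using Hub_class z by auto
    then have "m - 2 \<le> card (T' - X - {z, z})" using c(2) z finite_RST by simp
    then obtain U where "filler X (U @ [z])" using ex_filler_T[of X z z] c(1) zT z by blast
    then show ?thesis by force
  qed
qed

lemma ex_Hub:
  assumes "t \<in> T'" shows "\<exists>z\<in>Hub. z \<noteq> t"
  using cases_m
proof
  assume "m = 1 \<and> 2 \<le> card R \<and> card T' = 1"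
  then obtain r where "r \<in> R" using ex_two_elements by blast
  then show ?thesis using assms in_class(3)[of t] by (auto simp: Hub_def)
next
  assume m: "2 \<le> m"
  then obtain z z' where "z \<in> T'" "z' \<in> T'" "z \<noteq> z'" using ex_two_elements[of T'] cardT by force
  then show ?thesis using m unfolding Hub_def by (metis UnI2)
qed

text \<open>For \<open>m = 1\<close> the set \<open>Hub\<close> is just \<open>R\<close>, so a
  second \<open>R\<close>-node has to exist; for \<open>2 \<le> m\<close> a second inner
  \<open>T\<close>-node serves.\<close>

lemma ex_Hub2:
  assumes "t \<in> T'" "r \<in> R" shows "\<exists>z\<in>Hub. z \<noteq> t \<and> z \<noteq> r"
  using cases_m
proof
  assume "m = 1 \<and> 2 \<le> card R \<and> card T' = 1"
  then obtain z z' where "z \<in> R" "z' \<in> R" "z \<noteq> z'" using ex_two_elements by blast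
  moreover have "t \<notin> R" using assms in_class(3)[of t] by auto
  ultimately show ?thesis unfolding Hub_def by (metis UnI1)
next
  assume m: "2 \<le> m"
  then obtain z z' where "z \<in> T'" "z' \<in> T'" "z \<noteq> z'" using ex_two_elements[of T'] cardT by force
  moreover have "r \<notin> T'" using assms in_class(1)[of r] in_class(3)[of r] by auto
  ultimately show ?thesis using m unfolding Hub_def by (metis UnI2)
qed

end

text \<open>The conditions \<open>norm_Sn\<close>, \<open>norm_ST\<close> and \<open>norm_S\<close> can be reached from an arbitrary functional by
  subtracting a node potential.\<close>

locale gmc_normal = gmc_facet +
  fixes c :: vec and K e :: real and s0 t0 :: nat
  assumes const: "\<And>xs. xs \<in> mids n p \<Longrightarrow> val xs = bnd \<Longrightarrow> wsum c (stpath n xs) = K"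
    and s0: "s0 \<in> S" and t0: "t0 \<in> T'"
    and norm_Sn: "\<And>s. s \<in> S \<Longrightarrow> c (s, n) = 0"
    and norm_ST: "\<And>t. t \<in> T' \<Longrightarrow> c (s0, t) = 0"
    and norm_S: "c (0, s0) = e" "\<And>r. r \<in> R \<Longrightarrow> c (r, s0) = e" "c (t0, s0) = e"
begin

section \<open>Exchanges that determine the arc costs\<close>

lemma cost:
  assumes W: "filler ({s, s', t} \<union> Y) W" and st: "s \<in> S" "s' \<in> S" "t \<in> T'" and Y: "Y \<subseteq> R"
    and Q: "distinct (Q1 @ Q2)" "set (Q1 @ Q2) \<subseteq> {s, s', t} \<union> Y" "length (Q1 @ Q2) = card Y + 2"
    and l: "last (0 # Q1) \<notin> S"
    and slack: "wsum sig (0 # Q1) + of_bool (hd (Q2 @ [n]) \<in> T) + wsum sig (Q2 @ [n])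
      + real (card (Y - set (Q1 @ Q2))) = 1"
  shows "wsum c (0 # Q1) + c (last (0 # Q1), hd W) + wsum c W
      + c (last W, hd (Q2 @ [n])) + wsum c (Q2 @ [n]) = K"
proof -
  have X: "R \<inter> ({s, s', t} \<union> Y) = Y" using st Y disjoint by blast
  have "{s, s', t} \<union> Y \<subseteq> {0<..<n}" using st Y nodes by blast
  then have Q': "set (Q1 @ Q2) \<subseteq> ({s, s', t} \<union> Y) \<inter> {0<..<n}" using Q(2) by blast
  show ?thesis
    using tight_insert_filler[OF W X Q(1) Q' Q(3) l slack] const by metis
qed

lemma ex_filler_cost:
  assumes "s \<in> S" "s' \<in> S" "t \<in> T'" "Y \<subseteq> R" "z \<in> Hub" "z \<noteq> t" "z \<notin> Y"
  shows "\<exists>W. filler ({s, s', t} \<union> Y) W \<and> last W = z"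
proof (rule ex_filler)
  have "S \<inter> ({s, s', t} \<union> Y) \<subseteq> {s, s'}" "T' \<inter> ({s, s', t} \<union> Y) \<subseteq> {t}"
    using assms disjoint by blast+
  then have "card (S \<inter> ({s, s', t} \<union> Y)) \<le> card {s, s'}" "card (T' \<inter> ({s, s', t} \<union> Y)) \<le> card {t}"
    by (intro card_mono; simp)+
  moreover have "card {s, s'} \<le> 2" by (simp add: card_insert_le_m1)
  ultimately show "card (S \<inter> ({s, s', t} \<union> Y)) \<le> 2" "card (T' \<inter> ({s, s', t} \<union> Y)) \<le> 1" by simp_all
  show "finite ({s, s', t} \<union> Y)" using assms(4) finite_RST finite_subset by auto
  show "z \<notin> {s, s', t} \<union> Y" using assms Hub_class disjoint by blast
qed (fact assms)

lemma class_neq: "s \<in> S \<Longrightarrow> t \<in> T' \<Longrightarrow> s \<noteq> t \<and> t \<noteq> s" "r \<in> R \<Longrightarrow> t \<in> T' \<Longrightarrow> r \<noteq> t \<and> t \<noteq> r"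
  "r \<in> R \<Longrightarrow> s \<in> S \<Longrightarrow> r \<noteq> s \<and> s \<noteq> r"
  using disjoint by auto

lemmas cls = in_class endpoints endpoints_class

lemma TS_indep: assumes "s \<in> S" "t \<in> T'" shows "c (t, s) = c (t, s0)"
proof -
  obtain z where z: "z \<in> Hub" "z \<noteq> t" using ex_Hub assms by blast
  obtain W where W: "filler ({s, s0, t} \<union> {}) W" "last W = z"
    using ex_filler_cost[OF assms(1) s0 assms(2) _ z] by blast
  show ?thesis
    using cost[OF W(1), of "[]" "[t, s]"] cost[OF W(1), of "[]" "[t, s0]"] assms s0 norm_Sn class_neq(1)[OF assms] class_neq(1)[OF s0 assms(2)]
      endpoints endpoints_class
      in_class(3)[OF assms(2)] in_class(2)[OF assms(1)] in_class(2)[OF s0]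
    by (auto simp: sig_def)
qed

text \<open>The filler ends in \<open>r\<close> and is followed by \<open>s\<close> or
  \<open>s0\<close>; placing \<open>t0\<close> directly after \<open>0\<close> uses up the single
  defect.\<close>

lemma RS_eq: assumes "s \<in> S" "r \<in> R" shows "c (r, s) = e"
proof -
  have "r \<in> Hub" "r \<noteq> t0" using assms disjoint t0 by (auto simp: Hub_def)
  then obtain W where W: "filler ({s, s0, t0} \<union> {}) W" "last W = r"
    using ex_filler_cost[OF assms(1) s0 t0, of "{}"] by blast
  show ?thesis
    using cost[OF W(1), of "[t0]" "[s]"] cost[OF W(1), of "[t0]" "[s0]"] W(2) assms s0 t0 norm_Sn norm_S
      class_neq(1)[OF assms(1) t0] class_neq(1)[OF s0 t0]
      in_class(3)[OF t0] in_class(2)[OF assms(1)] in_class(2)[OF s0] endpoints endpoints_class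
    by (auto simp: sig_def)
qed

lemma HubS: "s \<in> S \<Longrightarrow> z \<in> Hub \<Longrightarrow> c (z, s) = c (z, s0)"
  using Hub_class TS_indep RS_eq s0 by metis

lemma ST_eq: assumes "s \<in> S" "t \<in> T'" shows "c (s, t) = 0"
proof -
  obtain z where z: "z \<in> Hub" "z \<noteq> t" using ex_Hub assms by blast
  obtain W where W: "filler ({s, s0, t} \<union> {}) W" "last W = z"
    using ex_filler_cost[OF assms(1) s0 assms(2) _ z] by blast
  show ?thesis
    using cost[OF W(1), of "[]" "[s, t]"] cost[OF W(1), of "[]" "[s0, t]"] W(2) assms s0
      class_neq(1)[OF assms] class_neq(1)[OF s0 assms(2)]
      HubS[OF assms(1) z(1)] norm_ST[OF assms(2)]
      in_class(3)[OF assms(2)] in_class(2)[OF assms(1)] in_class(2)[OF s0] endpoints endpoints_class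
    by (auto simp: sig_def)
qed

lemma sourceS_eq: assumes "s \<in> S" shows "c (0, s) = e"
proof -
  obtain z where z: "z \<in> Hub" "z \<noteq> t0" using ex_Hub t0 by blast
  obtain W where W: "filler ({s, s0, t0} \<union> {}) W" "last W = z"
    using ex_filler_cost[OF assms(1) s0 t0 _ z] by blast
  show ?thesis
    using cost[OF W(1), of "[s, t0]" "[]"] cost[OF W(1), of "[s0, t0]" "[]"] W(2) assms s0 t0
      class_neq(1)[OF assms t0] class_neq(1)[OF s0 t0]
      ST_eq[OF assms t0] norm_ST[OF t0] norm_S(1)
      in_class(3)[OF t0] in_class(2)[OF assms(1)] in_class(2)[OF s0] endpoints endpoints_class
    by (auto simp: sig_def)
qed

lemma two_S: "\<exists>s\<in>S. \<exists>s'\<in>S. s \<noteq> s'"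
  using ex_two_elements[of S] cardS m1 by simp

lemma T'_single: "m = 1 \<Longrightarrow> t \<in> T' \<Longrightarrow> t' \<in> T' \<Longrightarrow> t = t'"
proof -
  assume m: "m = 1" and t: "t \<in> T'" "t' \<in> T'"
  have "card T' = 1" using cases_m m by linarith
  then obtain x where "T' = {x}" by (rule card_1_singletonE)
  then show ?thesis using t by simp
qed

text \<open>\<open>TS_indep\<close> fixes the \<open>T\<close>-node; here two \<open>T\<close>-nodes
  are compared. Two fillers differing only in the last node, \<open>t\<close> or \<open>t0\<close>,
  are followed by \<open>s, s1\<close>, with \<open>(s, s1)\<close> as the defect. The arcs into
  \<open>t\<close> and \<open>t0\<close> cost 0, so only the arcs into \<open>s\<close>
  differ.\<close>

lemma TS_eq: assumes "s \<in> S" "t \<in> T'" shows "c (t, s) = e"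
proof (cases "t = t0")
  case True
  then show ?thesis using TS_indep[OF assms(1) t0] norm_S(3) by simp
next
  case False
  then have m2: "2 \<le> m" using T'_single assms t0 cases_m by metis
  obtain s1 where s1: "s1 \<in> S" "s1 \<noteq> s" using two_S by metis
  define X where "X = {s, s1}"
  have S: "card (S - X) = card S - 2" using assms s1 by (subst card_Diff_subset) (auto simp: X_def)
  have TX: "T' - X = T'" using assms s1 disjoint by (auto simp: X_def)
  have "card (T' - X - {t, t0}) = card T' - 2"
    using assms t0 False unfolding TX by (subst card_Diff_subset) auto
  then have "\<exists>U. filler X (U @ [t]) \<and> filler X (U @ [t0]) \<and> U \<noteq> [] \<and> last U \<in> S \<and> (0 \<in> R - X \<longrightarrow> hd U = 0)"
    using assms t0 m2 cardS cardT S TX by (intro ex_filler_T) auto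
  then obtain U where U: "filler X (U @ [t])" "filler X (U @ [t0])" "U \<noteq> []" "last U \<in> S" by blast
  have RX: "R \<inter> X = {}" using assms s1 disjoint by (auto simp: X_def)
  have cls: "0 < s" "s < n" "s \<notin> T" "0 < s1" "s1 < n" "s1 \<notin> T"
    using in_class(2)[OF assms(1)] in_class(2)[OF s1(1)] by auto
  have "c (0, hd U) + wsum c U + c (y, s) + c (s, s1) = K" if y: "y = t \<or> y = t0" for y
  proof -
    have f: "filler X (U @ [y])" and yT: "y \<in> T'" using y U assms t0 by auto
    have "wsum c (stpath n ([] @ (U @ [y]) @ [s, s1])) = K"
      by (rule const; rule tight_insert_filler(1)[THEN conjunct1] tight_insert_filler(1)[THEN conjunct2];
          (rule f RX)?; use assms s1 cls endpoints endpoints_class in \<open>auto simp: X_def sig_def\<close>)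
    moreover have "wsum c (stpath n ([] @ (U @ [y]) @ [s, s1]))
        = c (0, hd U) + wsum c (U @ [y]) + c (y, s) + c (s, s1) + c (s1, n)"
      using wsum_Cons_append[of "U @ [y]" c 0 s "[s1, n]"] U(3) by simp
    moreover have "wsum c (U @ [y]) = wsum c U"
      using wsum_append[OF U(3), of "[y]" c] ST_eq[OF U(4) yT] by simp
    ultimately show ?thesis using norm_Sn[OF s1(1)] by simp
  qed
  from this[of t] this[of t0] have "c (t, s) = c (t0, s)" by simp
  then show ?thesis using TS_indep[OF assms(1) t0] norm_S(3) by simp
qed

lemma HubS_eq: "s \<in> S \<Longrightarrow> z \<in> Hub \<Longrightarrow> c (z, s) = e"
  using Hub_class TS_eq RS_eq by metis

text \<open>Reversing \<open>s0, t\<close> after the filler moves the defect from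
  \<open>(t, n)\<close> to \<open>(z, t)\<close>.\<close>

lemma HubT_eq:
  assumes t: "t \<in> T'" and z: "z \<in> Hub" "z \<noteq> t"
  shows "c (z, t) = c (t, n)"
proof -
  obtain W where W: "filler ({s0, s0, t} \<union> {}) W" "last W = z"
    using ex_filler_cost[OF s0 s0 t _ z] by blast
  show ?thesis
    using cost[OF W(1), of "[]" "[s0, t]"] cost[OF W(1), of "[]" "[t, s0]"] W(2) s0 t class_neq(1)[OF s0 t]
      HubS_eq[OF s0 z(1)] norm_ST[OF t] TS_eq[OF s0 t] norm_Sn[OF s0]
      in_class(3)[OF t] in_class(2)[OF s0] endpoints endpoints_class
    by (auto simp: sig_def)
qed

text \<open>In \<open>z, r, t, s0\<close> and \<open>z, t, r, s0\<close> the defect is the arc into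
  \<open>t\<close>, whose cost is \<open>c (t, n)\<close> both times.\<close>

lemma HubR_eq:
  assumes r: "r \<in> R" and t: "t \<in> T'" and z: "z \<in> Hub" "z \<noteq> t" "z \<noteq> r"
  shows "c (z, r) = c (t, r)"
proof -
  obtain W where W: "filler ({s0, s0, t} \<union> {r}) W" "last W = z"
    using ex_filler_cost[OF s0 s0 t _ z(1,2), of "{r}"] r z by blast
  have "r \<in> Hub" "r \<noteq> t" using r t disjoint by (auto simp: Hub_def)
  then have "c (r, t) = c (t, n)" using HubT_eq t by blast
  then show ?thesis
    using cost[OF W(1), of "[]" "[r, t, s0]"] cost[OF W(1), of "[]" "[t, r, s0]"] W(2) s0 t r
      class_neq(1)[OF s0 t] class_neq(2)[OF r t] class_neq(3)[OF r s0]
      HubT_eq[OF t z(1,2)] TS_eq[OF s0 t] RS_eq[OF s0 r]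
      in_class(3)[OF t] in_class(2)[OF s0] in_class(1)[OF r] endpoints endpoints_class
    by (auto simp: sig_def)
qed

text \<open>Moving \<open>r\<close> from the end of \<open>s0, t, r\<close> to the front moves the
  defect from \<open>(r, n)\<close> to \<open>(t, n)\<close>.\<close>

lemma Rn_eq:
  assumes r: "r \<in> R" and t: "t \<in> T'"
  shows "c (r, n) = c (t, n)"
proof -
  obtain z where z: "z \<in> Hub" "z \<noteq> t" "z \<noteq> r" using ex_Hub2 r t by blast
  obtain W where W: "filler ({s0, s0, t} \<union> {r}) W" "last W = z"
    using ex_filler_cost[OF s0 s0 t _ z(1,2), of "{r}"] r z by blast
  show ?thesis
    using cost[OF W(1), of "[]" "[s0, t, r]"] cost[OF W(1), of "[]" "[r, s0, t]"] W(2) s0 t r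
      class_neq(1)[OF s0 t] class_neq(2)[OF r t] class_neq(3)[OF r s0]
      HubR_eq[OF r t z] HubS_eq[OF s0 z(1)] RS_eq[OF s0 r]
      in_class(3)[OF t] in_class(2)[OF s0] in_class(1)[OF r] endpoints endpoints_class
    by (auto simp: sig_def)
qed

text \<open>Three tight paths arise by rotating the segments: \<open>s0, t, W\<close>, then
  \<open>t, W, s0\<close>, then \<open>W, s0, t\<close>.\<close>

lemma filler_positions:
  assumes t: "t \<in> T'" and W: "filler ({s0, s0, t} \<union> {}) W" and z: "c (last W, s0) = e"
  shows "c (0, t) = c (last W, n)" "c (t, hd W) + c (last W, n) = c (0, hd W) + c (t, n)"
proof -
  note f = s0 t class_neq(1)[OF s0 t] in_class(3)[OF t] in_class(2)[OF s0] endpoints endpoints_class norm_S(1) norm_ST[OF t] norm_Sn[OF s0]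
  have A: "e + c (t, hd W) + wsum c W + c (last W, n) = K"
    using cost[OF W, of "[s0, t]" "[]"] f by (auto simp: sig_def)
  moreover have B: "c (0, t) + c (t, hd W) + wsum c W + e = K"
    using cost[OF W, of "[t]" "[s0]"] f z by (auto simp: sig_def)
  moreover have C: "c (0, hd W) + wsum c W + e + c (t, n) = K"
    using cost[OF W, of "[]" "[s0, t]"] f z by (auto simp: sig_def)
  ultimately show "c (0, t) = c (last W, n)" "c (t, hd W) + c (last W, n) = c (0, hd W) + c (t, n)"
    by simp_all
qed

lemma sourceT_Hub:
  assumes t: "t \<in> T'" and z: "z \<in> Hub" "z \<noteq> t"
  shows "c (0, t) = c (z, n)"
proof -
  obtain W where "filler ({s0, s0, t} \<union> {}) W" "last W = z"
    using ex_filler_cost[OF s0 s0 t _ z] by blast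
  then show ?thesis using filler_positions[OF t] HubS_eq[OF s0 z(1)] by blast
qed

lemma sourceT_sink:
  assumes t: "t \<in> T'"
  shows "c (0, t) = c (t, n)"
proof (cases "R = {}")
  case False
  then obtain r where r: "r \<in> R" by blast
  then have "r \<in> Hub" "r \<noteq> t" using t disjoint by (auto simp: Hub_def)
  then show ?thesis using sourceT_Hub[OF t] Rn_eq[OF r t] by simp
next
  \<comment> \<open>Without \<open>R\<close>-nodes the filler must start in \<open>S\<close>, where
    arcs from \<open>t\<close> and from \<open>0\<close> both cost \<open>e\<close>.\<close>
  case True
  obtain z where z: "z \<in> Hub" "z \<noteq> t" using ex_Hub t by blast
  obtain W where W: "filler ({s0, s0, t} \<union> {}) W" "last W = z"
    using ex_filler_cost[OF s0 s0 t _ z] by blast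
  have "hd W \<in> {0<..<n}" "hd W \<notin> T"
    using W(1) hd_in_set[of W] unfolding filler_def by blast+
  then have "hd W \<in> S" using True unfolding nodes(4)[symmetric] by (auto simp: T'_def)
  then show ?thesis
    using filler_positions[OF t W(1)] W(2) HubS_eq[OF s0 z(1)] TS_eq[OF _ t] sourceS_eq by simp
qed

text \<open>Together with \<open>e\<close> the parameter of the final family: the common cost of all
  arcs into \<open>T\<close> from outside \<open>S\<close> and of all arcs within
  \<open>S\<close>.\<close>

definition "u = c (t0, n)"

lemma Tn_eq: assumes "t \<in> T'" shows "c (t, n) = u"
proof (cases "t = t0")
  case False
  then have "2 \<le> m" using T'_single assms t0 cases_m by metis
  then have "t0 \<in> Hub" using t0 by (simp add: Hub_def)
  then show ?thesis using sourceT_Hub[OF assms, of t0] sourceT_sink[OF assms] False by (simp add: u_def)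
qed (simp add: u_def)

lemma sourceT_eq: "t \<in> T' \<Longrightarrow> c (0, t) = u" using sourceT_sink Tn_eq by simp

lemma Rn_u: "r \<in> R \<Longrightarrow> c (r, n) = u" using Rn_eq[OF _ t0] Tn_eq[OF t0] by simp

lemma T'_Hub: "t \<in> T' \<Longrightarrow> t' \<in> T' \<Longrightarrow> t \<noteq> t' \<Longrightarrow> t \<in> Hub"
  using T'_single cases_m by (auto simp: Hub_def)

lemma RTT_eq: "a \<in> R \<union> T' \<Longrightarrow> t \<in> T' \<Longrightarrow> a \<noteq> t \<Longrightarrow> c (a, t) = u"
  using HubT_eq[of t a] Tn_eq[of t] T'_Hub[of a t] by (auto simp: Hub_def)

text \<open>\<open>filler_positions\<close> compares the arcs from \<open>t\<close> and from
  \<open>0\<close> into the first node of the filler, so a filler starting with \<open>r\<close> is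
  wanted.\<close>

lemma TR_eq: assumes r: "r \<in> R" and t: "t \<in> T'" shows "c (t, r) = c (0, r)"
proof -
  have "\<exists>W. filler ({s0, s0, t} \<union> {}) W \<and> hd W = r"
    using cases_m
  proof
    assume m: "m = 1 \<and> 2 \<le> card R \<and> card T' = 1"
    then obtain r' where "r' \<in> R" "r' \<noteq> r" using ex_two_elements by metis
    then show ?thesis using ex_filler_R_first[of r "{s0, s0, t} \<union> {}" r'] m r s0 t disjoint by auto
  next
    assume m: "2 \<le> m"
    obtain z where z: "z \<in> T'" "z \<noteq> t" using ex_two_elements[of T'] cardT m by (metis order_trans)
    define X where "X = {s0, s0, t} \<union> {}"
    have X: "S - X = S - {s0}" "T' - X - {z, z} = T' - {t, z}" "r \<in> R - X" "z \<in> T' - X"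
      using s0 t z r disjoint by (auto simp: X_def)
    have "m - 1 \<le> card (S - X)" using cardS s0 finite_RST unfolding X by simp
    moreover have "m - 2 \<le> card (T' - X - {z, z})"
      using cardT t z unfolding X by (subst card_Diff_subset) auto
    ultimately obtain U where "filler X (U @ [z])" "U \<noteq> []" "hd U = r"
      using ex_filler_T[OF m, of X z z r] X by blast
    then show ?thesis unfolding X_def by (metis hd_append2)
  qed
  then obtain W where W: "filler ({s0, s0, t} \<union> {}) W" "hd W = r" by blast
  have "last W \<in> {0<..<n}" "last W \<notin> S" using W(1) last_in_set[of W] unfolding filler_def by blast+
  then have "last W \<in> R \<union> T'" using nodes(4) by blast
  then have "c (last W, s0) = e" "c (last W, n) = u" using RS_eq TS_eq s0 Rn_u Tn_eq by auto
  then show ?thesis using filler_positions(2)[OF t W(1)] W(2) Tn_eq[OF t] by simp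
qed

lemma RTR_eq: "a \<in> R \<union> T' \<Longrightarrow> r \<in> R \<Longrightarrow> a \<noteq> r \<Longrightarrow> c (a, r) = c (0, r)"
  using HubR_eq[of r t0 a] TR_eq t0 disjoint by (auto simp: Hub_def)

text \<open>Trades one kind of defect for the other: \<open>(s, s')\<close> leaves \<open>S\<close>
  without reaching \<open>T\<close>, while \<open>(t0, n)\<close> enters \<open>T\<close> from
  outside \<open>S\<close>.\<close>

lemma SS_eq: assumes s: "s \<in> S" "s' \<in> S" "s \<noteq> s'" shows "c (s, s') = u"
proof -
  obtain z where z: "z \<in> Hub" "z \<noteq> t0" using ex_Hub t0 by blast
  obtain W where W: "filler ({s, s', t0} \<union> {}) W" "last W = z"
    using ex_filler_cost[OF s(1,2) t0 _ z] by blast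
  show ?thesis
    using cost[OF W(1), of "[]" "[s, s']"] cost[OF W(1), of "[]" "[s, t0]"] W(2) s t0 class_neq(1)[OF s(1) t0] class_neq(1)[OF s(2) t0]
      ST_eq[OF s(1) t0] norm_Sn Tn_eq[OF t0]
      in_class(3)[OF t0] in_class(2)[OF s(1)] in_class(2)[OF s(2)] endpoints endpoints_class
    by (auto simp: sig_def)
qed

text \<open>The exchange that uses the third kind of defect: \<open>s, t0, s'\<close> is tight
  because it misses \<open>r\<close>, whereas \<open>r, s, t0\<close> visits \<open>r\<close> and
  has the defect \<open>(t0, n)\<close>.\<close>

lemma sourceR_eq: assumes r: "r \<in> R" shows "c (0, r) = e - u"
proof -
  obtain s s' where s: "s \<in> S" "s' \<in> S" "s \<noteq> s'" using two_S by blast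
  obtain z where z: "z \<in> Hub" "z \<noteq> t0" "z \<noteq> r" using ex_Hub2 r t0 by blast
  obtain W where W: "filler ({s, s', t0} \<union> {r}) W" "last W = z"
    using ex_filler_cost[OF s(1,2) t0 _ z(1,2), of "{r}"] r z by blast
  have "c (z, r) = c (0, r)" using RTR_eq[OF _ r z(3)] Hub_class[OF z(1)] by blast
  then show ?thesis
    using cost[OF W(1), of "[]" "[s, t0, s']"] cost[OF W(1), of "[]" "[r, s, t0]"] W(2) s t0 r
      class_neq(1)[OF s(1) t0] class_neq(1)[OF s(2) t0] class_neq(2)[OF r t0] class_neq(3)[OF r s(1)] class_neq(3)[OF r s(2)]
      ST_eq[OF s(1) t0] norm_Sn Tn_eq[OF t0] HubS_eq[OF s(1) z(1)] TS_eq[OF s(2) t0] RS_eq[OF s(1) r]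
      in_class(3)[OF t0] in_class(2)[OF s(1)] in_class(2)[OF s(2)] in_class(1)[OF r] endpoints endpoints_class
    by (auto simp: sig_def)
qed

text \<open>In \<open>s, r, s'\<close> and \<open>r, s, s'\<close> the node \<open>s\<close> carries
  the defect; every cost except \<open>c (s, r)\<close> is already known.\<close>

lemma SR_eq: assumes s: "s \<in> S" and r: "r \<in> R" shows "c (s, r) = 0"
proof -
  obtain s' where s': "s' \<in> S" "s' \<noteq> s" using two_S by metis
  obtain z where z: "z \<in> Hub" "z \<noteq> t0" "z \<noteq> r" using ex_Hub2 r t0 by blast
  obtain W where W: "filler ({s, s', t0} \<union> {r}) W" "last W = z"
    using ex_filler_cost[OF s s'(1) t0 _ z(1,2), of "{r}"] r z by blast
  have "c (z, r) = e - u" using RTR_eq[OF _ r z(3)] Hub_class[OF z(1)] sourceR_eq[OF r] by fastforce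
  then show ?thesis
    using cost[OF W(1), of "[]" "[s, r, s']"] cost[OF W(1), of "[]" "[r, s, s']"] W(2) s s' t0 r
      class_neq(1)[OF s t0] class_neq(1)[OF s'(1) t0] class_neq(2)[OF r t0] class_neq(3)[OF r s] class_neq(3)[OF r s'(1)]
      SS_eq[OF s s'(1)] HubS_eq[OF s z(1)] RS_eq[OF s r] RS_eq[OF s'(1) r]
      in_class(3)[OF t0] in_class(2)[OF s] in_class(2)[OF s'(1)] in_class(1)[OF r] endpoints endpoints_class
    by (auto simp: sig_def)
qed

lemma normal_form:
  assumes "(i, j) \<in> arcs n"
  shows "c (i, j) = (if i \<in> S then if j \<in> S then u else 0
    else if j \<in> T then u else if j \<in> S then e else e - u)"
proof -
  have V: "v = 0 \<or> v = n \<or> v \<in> R \<or> v \<in> S \<or> v \<in> T'" if "v \<le> n" for v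
  proof (cases "v = 0 \<or> v = n")
    case False
    then have "v \<in> R \<union> S \<union> T'" using that unfolding nodes(4) by simp
    then show ?thesis by blast
  qed blast
  have i: "i = 0 \<or> i \<in> R \<or> i \<in> S \<or> i \<in> T'" and j: "j = n \<or> j \<in> R \<or> j \<in> S \<or> j \<in> T'"
    and ij: "i \<noteq> j" "\<not> (i = 0 \<and> j = n)"
    using assms V[of i] V[of j] unfolding arcs_iff by blast+
  show ?thesis
    using i
  proof (elim disjE)
    assume i: "i = 0"
    then show ?thesis using j ij sourceR_eq sourceS_eq sourceT_eq cls by auto
  next
    assume i: "i \<in> R"
    then have "i \<notin> S" using cls by auto
    then show ?thesis
      using j i ij RTR_eq[of i j] sourceR_eq[of j] RS_eq[of j i] RTT_eq[of i j] Rn_u[of i] cls by auto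
  next
    assume i: "i \<in> S"
    then show ?thesis using j ij SR_eq[of i j] SS_eq[of i j] ST_eq[of i j] norm_Sn[of i] cls by auto
  next
    assume i: "i \<in> T'"
    then have "i \<notin> S" using cls by auto
    then show ?thesis
      using j i ij RTR_eq[of i j] sourceR_eq[of j] TS_eq[of j i] RTT_eq[of i j] Tn_eq[of i] cls by auto
  qed
qed

end

section \<open>From the normal form back to arbitrary functionals\<close>

context gmc_facet
begin

lemma ex_tight_and_nontight:
  "\<exists>xs\<in>mids n p. val xs = bnd" "\<exists>xs\<in>mids n p. val xs \<noteq> bnd"
proof -
  obtain s where s: "s \<in> S" using cardS by fastforce
  obtain t where t: "t \<in> T'" using cardT m1 by fastforce
  obtain z where z: "z \<in> Hub" "z \<noteq> t" using ex_Hub[OF t] by blast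
  have st: "0 < s" "s < n" "s \<notin> T" "s \<notin> R" "0 < t" "t < n" "t \<in> T" "t \<notin> S" "t \<notin> R" "s \<noteq> t"
    using in_class(2)[OF s] in_class(3)[OF t] by auto
  have "z \<notin> {s, t}" using z Hub_class[OF z(1)] s disjoint by auto
  moreover have "S \<inter> {s, t} = {s}" "T' \<inter> {s, t} = {t}" using s t disjoint by auto
  ultimately obtain W where W: "filler {s, t} W" using ex_filler[of "{s, t}" z] z by auto
  note W' = W[unfolded filler_def]
  have X: "R \<inter> {s, t} = {}" "R - {s, t} = R" using st by auto
  have "[] @ W @ [s, t] \<in> mids n p \<and> val ([] @ W @ [s, t]) = bnd"
    by (rule tight_insert_filler(1)[OF W X(1)])
      (use s st endpoints endpoints_class in \<open>auto simp: sig_def\<close>)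
  then show "\<exists>xs\<in>mids n p. val xs = bnd" by blast
  \<comment> \<open>Splitting \<open>s, t\<close> around the filler creates three defects:
    \<open>s\<close> is not followed by a \<open>T\<close>-node, and neither \<open>t\<close> nor
    \<open>n\<close> is preceded by an \<open>S\<close>-node.\<close>
  have M: "s # W @ [t] \<in> mids n p" using W' st p_eq m1 X by (auto simp: mids_def)
  have "wsum sig (stpath n (s # W @ [t])) = sig (0, s) + sig (s, hd W) + sig (last W, t) + sig (t, n)"
    using wsum_Cons_append[of W sig s t "[n]"] W' by simp
  also have "\<dots> = 3" using W' s st endpoints endpoints_class by (simp add: sig_def)
  finally have "val (s # W @ [t]) \<noteq> bnd" using tight_iff[OF M] mod_less_divisor[of 2 "p + card R"] by linarith
  then show "\<exists>xs\<in>mids n p. val xs \<noteq> bnd" using M by blast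
qed

lemma functional_multiple:
  assumes zero: "\<And>xs. xs \<in> mids n p \<Longrightarrow> val xs = bnd \<Longrightarrow> wsum c (stpath n xs) = 0"
  shows "\<exists>l. \<forall>xs\<in>mids n p. wsum c (stpath n xs) = l * (val xs - bnd)"
proof -
  obtain s0 where s0: "s0 \<in> S" using cardS by fastforce
  obtain t0 where t0: "t0 \<in> T'" using cardT m1 by fastforce
  \<comment> \<open>The potential is solved from the normalisation with value 0 at \<open>n\<close>:
    the arcs \<open>(s, n)\<close> fix it on \<open>S\<close>, the arcs \<open>(s0, t)\<close> on
    \<open>T'\<close>, and the arcs into \<open>s0\<close> on \<open>R\<close> and at
    \<open>0\<close>. The arc \<open>(t0, s0)\<close> dictates \<open>e\<close>.\<close>
  define \<pi>t where "\<pi>t t = c (s0, n) - c (s0, t)" for t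
  define e where "e = c (t0, s0) - \<pi>t t0 + c (s0, n)"
  define \<pi> where "\<pi> i = (if i = n then 0 else if i \<in> S then c (i, n) else if i \<in> T' then \<pi>t i
    else c (i, s0) + c (s0, n) - e)" for i
  define d :: vec where "d = (\<lambda>(i, j). c (i, j) - \<pi> i + \<pi> j)"
  have wd: "wsum d (stpath n xs) = wsum c (stpath n xs) - \<pi> 0 + \<pi> n" for xs
    using wsum_potential[of c \<pi> 0 "xs @ [n]"] by (simp add: d_def)
  have ne: "n \<notin> S" "n \<noteq> 0" "0 \<notin> S" "n \<notin> T'" "0 \<notin> T'" using endpoints_class n5 by (auto simp: T'_def)
  have st: "s \<notin> T'" "s \<noteq> n" if "s \<in> S" for s using that disjoint ne by auto
  have ts: "t \<notin> S" "t \<noteq> n" if "t \<in> T'" for t using that disjoint ne by auto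
  have rs: "r \<notin> S" "r \<notin> T'" "r \<noteq> n" if "r \<in> R" for r using that disjoint endpoints_class by auto
  interpret gmc_normal n p R S T m d "- \<pi> 0" e s0 t0
  proof
    show "wsum d (stpath n xs) = - \<pi> 0" if "xs \<in> mids n p" "val xs = bnd" for xs
      using zero[OF that] wd[of xs] by (simp add: \<pi>_def)
    show "s0 \<in> S" "t0 \<in> T'" by fact+
    show "d (s, n) = 0" if "s \<in> S" for s using that ne st[OF that] by (simp add: d_def \<pi>_def)
    show "d (s0, t) = 0" if "t \<in> T'" for t
      using that s0 st[OF s0] ts[OF that] by (simp add: d_def \<pi>_def \<pi>t_def)
    show "d (0, s0) = e" using ne s0 st[OF s0] by (auto simp: d_def \<pi>_def)
    show "d (r, s0) = e" if "r \<in> R" for r using rs[OF that] s0 st[OF s0] by (simp add: d_def \<pi>_def)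
    show "d (t0, s0) = e" using t0 ts[OF t0] s0 st[OF s0] by (simp add: d_def \<pi>_def e_def)
  qed
  \<comment> \<open>A second potential, chosen so that all arcs with coefficient 0 in the inequality
    cost \<open>u\<close>; those with coefficient 1 then cost \<open>e - u = u + l\<close>.\<close>
  define \<rho> where "\<rho> i = (if i \<in> S then u - e else if i \<in> T then 0 else 2 * u - e)" for i
  define l where "l = e - 2 * u"
  have form: "d (i, j) - \<rho> i + \<rho> j = u + l * fcoef (i, j)" if a: "(i, j) \<in> arcs n" for i j
  proof -
    have V: "v \<in> R \<and> v \<notin> S \<and> v \<notin> T \<or> v \<in> S \<and> v \<notin> R \<and> v \<notin> T \<or> v \<in> T \<and> v \<notin> R \<and> v \<notin> S"
      if "v \<in> Vn n" for v using that part by blast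
    have "i \<in> Vn n" "j \<in> Vn n" using a by (auto simp: arcs_def)
    from V[OF this(1)] V[OF this(2)] show ?thesis
      unfolding normal_form[OF a] \<rho>_def l_def fcoef_def by (elim disjE) simp_all
  qed
  have "wsum c (stpath n xs) = (\<pi> 0 + \<rho> 0 - \<rho> n + u * real p) + l * val xs" if xs: "xs \<in> mids n p" for xs
  proof -
    have "wsum d (stpath n xs) - \<rho> 0 + \<rho> n = wsum (\<lambda>(i, j). d (i, j) - \<rho> i + \<rho> j) (stpath n xs)"
      using wsum_potential[of d \<rho> 0 "xs @ [n]"] by simp
    also have "\<dots> = wsum (\<lambda>a. 1 * u + l * fcoef a) (stpath n xs)"
      using path_arcs_in_arcs[OF pPath_stpath[OF xs]] form by (intro wsum_cong) auto
    also have "\<dots> = u * real p + l * val xs"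
    proof -
      have "length (xs @ [n]) = p" using xs p4 by (simp add: mids_def)
      then show ?thesis
        using wsum_linear[of 1 "\<lambda>_. u" l fcoef "stpath n xs"] wsum_const[of u 0 "xs @ [n]"] by simp
    qed
    finally show ?thesis using wd[of xs] by (simp add: \<pi>_def)
  qed
  then obtain C where C: "\<And>xs. xs \<in> mids n p \<Longrightarrow> wsum c (stpath n xs) = C + l * val xs" by blast
  \<comment> \<open>One tight path, on which the functional vanishes, fixes the additive
    constant.\<close>
  obtain ys where "ys \<in> mids n p" "val ys = bnd" using ex_tight_and_nontight(1) by blast
  then have "C + l * bnd = 0" using C[of ys] zero[of ys] by simp
  then have "\<forall>xs\<in>mids n p. wsum c (stpath n xs) = l * (val xs - bnd)"
    using C by (simp add: algebra_simps)
  then show ?thesis by blast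
qed

lemma facet: "facet"
proof -
  obtain x0 where x0: "x0 \<in> mids n p" "val x0 \<noteq> bnd" using ex_tight_and_nontight(2) by blast
  show ?thesis
  proof (rule facet_definingI[OF _ x0])
    show "val xs \<le> bnd" if "xs \<in> mids n p" for xs using that by (rule val_le)
    fix c assume "\<And>xs. xs \<in> mids n p \<Longrightarrow> val xs = bnd \<Longrightarrow> wsum c (stpath n xs) = 0"
    then show "\<exists>l. \<forall>xs\<in>mids n p. wsum c (stpath n xs) = l * (val xs - bnd)"
      by (rule functional_multiple)
  qed
qed

end

theorem theorem16:
  fixes n p :: nat and R S T :: "nat set"
  assumes "4 \<le> p" "p \<le> n - 1"
    and "R \<union> S \<union> T = Vn n" "R \<inter> S = {}" "R \<inter> T = {}" "S \<inter> T = {}"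
    and "0 \<in> T" "n \<in> T"
  shows "valid_ineq (pathPolytope n p) (gmc_lhs n R S T)
           (of_int \<lfloor>real (p + card R) / 2\<rfloor>)
    \<and> (facet_defining (pathPolytope n p) (gmc_lhs n R S T)
           (of_int \<lfloor>real (p + card R) / 2\<rfloor>)
       \<longleftrightarrow> odd (p + card R)
           \<and> real (card S) > (real p - real (card R)) / 2
           \<and> real (card (T - {0})) > (real p - real (card R)) / 2
           \<and> ((p = card R + 3 \<and> card R \<ge> 2 \<and> card T = 3) \<or> p \<ge> card R + 5))"
proof -
  interpret gmc n p R S T using assms by unfold_locales
  have fl: "of_int \<lfloor>real (p + card R) / 2\<rfloor> = bnd"
    using floor_divide_of_nat_eq[of "p + card R" 2, where 'a = real] by simp
  have T0: "card (T - {0}) = card T' + 1" using card_T finite_RST(3) endpoints by simp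
  have valid: "valid_ineq P (lin n fcoef) bnd" using valid_ineq_lin_iff val_le by blast
  have "facet \<longleftrightarrow> odd (p + card R) \<and> real (card S) > (real p - real (card R)) / 2
      \<and> real (card (T - {0})) > (real p - real (card R)) / 2
      \<and> ((p = card R + 3 \<and> card R \<ge> 2 \<and> card T = 3) \<or> p \<ge> card R + 5)" (is "_ \<longleftrightarrow> ?C")
  proof
    assume f: "facet"
    note imp = facet_imp[OF f]
    \<comment> \<open>Makes the truncated difference in \<open>facet_imp\<close> agree with the real
      one.\<close>
    then have "card R \<le> p" by linarith
    then show ?C using imp unfolding T0 card_T by (auto simp: field_simps)
  next
    assume C: ?C
    define m where "m = (p - card R) div 2"
    have "card R + 3 \<le> p" "odd (p - card R)" using C by auto
    then have "p = card R + 2 * m + 1" using odd_two_times_div_two_succ[of "p - card R"] by (simp add: m_def)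
    then interpret gmc_facet n p R S T m
      using C unfolding T0 card_T by unfold_locales auto
    show facet by (rule facet)
  qed
  then show ?thesis using valid unfolding fl gmc_lhs_eq by blast
qed

end
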